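(* Let $\mathbb G$ be a finitely generated torsion-free nilpotent group with word length $|\cdot|$ associated with a fixed finite symmetric generating set. Let $\mu$ be a symmetric probability measure on $\mathbb G$ for which there exist constants $r_0\ge3$ and $0<c_1\le c_2<\infty$ such that for all integers $r\ge r_0$, $$\frac{c_1}{r^2\log r}\ \le\ \sum_{|g|=r}\mu(g)\ \le\ \frac{c_2}{r^2\log r}.$$ Let $X_n=S_1S_2\cdots S_n$, where $(S_k)_{k\ge1}$ are i.i.d. with law $\mu$. Then $$\mathbb E|X_1|=\infty\qquad\text{and}\qquad\frac{|X_n|}{n}\to0\ \text{ in probability as } n\to\infty.$$
   Context: Symmetric means $\mu(g)=\mu(g^{-1})$ for all $g\in\mathbb G$. *)

theory Defs
  imports "HOL-Probability.Probability" "HOL-Algebra.Generated_Groups"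
begin

definition torsion_free :: "('a, 'b) monoid_scheme \<Rightarrow> bool" where
  "torsion_free G \<longleftrightarrow>
    (\<forall>x \<in> carrier G. \<forall>n::nat. n > 0 \<longrightarrow> x [^]\<^bsub>G\<^esub> n = \<one>\<^bsub>G\<^esub> \<longrightarrow> x = \<one>\<^bsub>G\<^esub>)"

definition commutator_subgroup ::
  "('a, 'b) monoid_scheme \<Rightarrow> 'a set \<Rightarrow> 'a set \<Rightarrow> 'a set" where
  "commutator_subgroup G H K =
    generate G {h \<otimes>\<^bsub>G\<^esub> k \<otimes>\<^bsub>G\<^esub> inv\<^bsub>G\<^esub> h \<otimes>\<^bsub>G\<^esub> inv\<^bsub>G\<^esub> k | h k. h \<in> H \<and> k \<in> K}"

(* The index is shifted by one: lower_central G 0 is the whole group. *)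
primrec lower_central :: "('a, 'b) monoid_scheme \<Rightarrow> nat \<Rightarrow> 'a set" where
  "lower_central G 0 = carrier G"
| "lower_central G (Suc n) = commutator_subgroup G (lower_central G n) (carrier G)"

definition nilpotent_group :: "('a, 'b) monoid_scheme \<Rightarrow> bool" where
  "nilpotent_group G \<longleftrightarrow> group G \<and> (\<exists>n. lower_central G n = {\<one>\<^bsub>G\<^esub>})"

definition symmetric_generating_set :: "('a, 'b) monoid_scheme \<Rightarrow> 'a set \<Rightarrow> bool" where
  "symmetric_generating_set G A \<longleftrightarrow>
    A \<subseteq> carrier G \<and> (\<forall>a \<in> A. inv\<^bsub>G\<^esub> a \<in> A) \<and> generate G A = carrier G"

definition list_mult :: "('a, 'b) monoid_scheme \<Rightarrow> 'a list \<Rightarrow> 'a" where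
  "list_mult G xs = foldr (\<otimes>\<^bsub>G\<^esub>) xs \<one>\<^bsub>G\<^esub>"

(* Words use letters of A only, not their inverses, so this is the usual word length
   when A is a symmetric generating set. *)
definition word_length :: "('a, 'b) monoid_scheme \<Rightarrow> 'a set \<Rightarrow> 'a \<Rightarrow> nat" where
  "word_length G A g = (LEAST n. \<exists>w. set w \<subseteq> A \<and> length w = n \<and> list_mult G w = g)"

definition symmetric_measure :: "('a, 'b) monoid_scheme \<Rightarrow> 'a measure \<Rightarrow> bool" where
  "symmetric_measure G \<mu> \<longleftrightarrow> (\<forall>g \<in> carrier G. measure \<mu> {g} = measure \<mu> {inv\<^bsub>G\<^esub> g})"

(* The product S 1 * ... * S n, with factors in increasing order of the index. *)
definition random_walk ::
  "('a, 'b) monoid_scheme \<Rightarrow> (nat \<Rightarrow> 'w \<Rightarrow> 'a) \<Rightarrow> nat \<Rightarrow> 'w \<Rightarrow> 'a" where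
  "random_walk G S n \<omega> = list_mult G (map (\<lambda>k. S k \<omega>) [1..<Suc n])"

definition tendsto_in_prob :: "'w measure \<Rightarrow> (nat \<Rightarrow> 'w \<Rightarrow> real) \<Rightarrow> real \<Rightarrow> bool" where
  "tendsto_in_prob M Y y \<longleftrightarrow>
    (\<forall>n. Y n \<in> borel_measurable M) \<and>
    (\<forall>\<epsilon>>0. (\<lambda>n. measure M {\<omega> \<in> space M. \<bar>Y n \<omega> - y\<bar> > \<epsilon>}) \<longlonglongrightarrow> 0)"

end

theory Submission
  imports Defs "HOL-Real_Asymp.Real_Asymp"
begin

text \<open>
  The mean is infinite because the spheres contribute
  \<open>\<Sum> r \<cdot> c\<^sub>1 / (r\<^sup>2 log r) = c\<^sub>1 \<Sum> 1 / (r log r) = \<infinity>\<close>.  The divergence is only doubly logarithmic,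
  so the steps that are responsible for it can be paid for by a first moment bound, while the
  cancellation coming from symmetry controls the rest.

  Fix \<open>n\<close> and put \<open>R = n / log\<^sup>4 n\<close>.  With high probability no step among the first \<open>n\<close> is longer
  than \<open>n\<close>, and the steps of length between \<open>R\<close> and \<open>n\<close> have total expected length of order at most
  \<open>n log (n / R) / log R = o(n)\<close>.  In an abelian group one would now bound the remaining sum of
  short steps by its variance.  In a non-commutative group the long steps cannot be separated from
  the short ones, so the steps are kept together and the law is damped instead: \<open>\<mu>(g)\<close> is
  multiplied by \<open>exp (-s |g|)\<close> for \<open>R < |g| \<le> n\<close> and by \<open>1\<close> for \<open>|g| \<le> R\<close>.  As long as the long
  steps have total length at most \<open>\<epsilon>n/2\<close>, the damping costs a factor of at most \<open>exp (s\<epsilon>n/2)\<close>.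

  The convolution powers of the damped law \<open>\<nu>\<close> decay off the identity like \<open>exp (-s |x|)\<close>.  This is
  a Combes--Thomas estimate (lemma \<open>Combes_Thomas\<close>): conjugating convolution by \<open>exp (s |x|)\<close>
  changes its quadratic form only through \<open>cosh (s (|x| - |y|))\<close>, because the kernel is symmetric and
  the first-order terms in \<open>s\<close> cancel.  So the Green function with killing rate of order \<open>1/n\<close>
  decays exponentially at every rate \<open>s\<close> with \<open>\<Sum> \<nu>(g) cosh (s |g|) \<le> 1 + 1/(4n)\<close>.  Here the damping
  is decisive: a long step contributes \<open>exp (-s |g|) cosh (s |g|) \<le> 1\<close>, and the short steps have
  second moment of order at most \<open>R\<close>; hence \<open>s\<close> of order \<open>1 / sqrt (n R)\<close> is admissible.

  Altogether the probability of \<open>|X\<^sub>n| > \<epsilon>n\<close> without long steps of total length \<open>\<epsilon>n/2\<close> is at most of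
  order \<open>n |B(n\<^sup>2)| exp (-s\<epsilon>n/2)\<close>, where \<open>B(n\<^sup>2)\<close> is the ball of radius \<open>n\<^sup>2\<close>, which contains the walk, and
  \<open>sn\<close> is of order \<open>sqrt (n / R) = log\<^sup>2 n\<close> (lemma \<open>prob_far_le\<close>).  Nilpotency enters through
  polynomial growth (lemma \<open>nilpotent_polynomial_growth\<close>): \<open>|B(n\<^sup>2)|\<close> is at most of the order of a power
  of \<open>n\<close>, which
  \<open>exp (-const log\<^sup>2 n)\<close> beats.
\<close>

section \<open>Polynomial growth of nilpotent groups\<close>

lemma list_mult_Nil [simp]: "list_mult G [] = \<one>\<^bsub>G\<^esub>"
  and list_mult_Cons [simp]: "list_mult G (x # xs) = x \<otimes>\<^bsub>G\<^esub> list_mult G xs"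
  by (simp_all add: list_mult_def)

definition word_ball :: "('a, 'b) monoid_scheme \<Rightarrow> 'a set \<Rightarrow> nat \<Rightarrow> 'a set" where
  "word_ball G A n = {list_mult G w | w. set w \<subseteq> A \<and> length w \<le> n}"

text \<open>
  Level \<open>j\<close> consists of the commutators \<open>[\<dots>[[a\<^sub>0, a\<^sub>1], a\<^sub>2] \<dots>, a\<^sub>j]\<close> with all entries in \<open>A\<close>, written in the
  form in which they arise when the letter \<open>a\<close> is moved to the left past \<open>x\<close>, that is with
  \<open>[x, a] = x\<inverse> a\<inverse> x a\<close>.
\<close>

primrec comm_level :: "('a, 'b) monoid_scheme \<Rightarrow> 'a set \<Rightarrow> nat \<Rightarrow> 'a set" where
  "comm_level G A 0 = A"
| "comm_level G A (Suc j) =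
    (\<lambda>(x, a). inv\<^bsub>G\<^esub> x \<otimes>\<^bsub>G\<^esub> inv\<^bsub>G\<^esub> a \<otimes>\<^bsub>G\<^esub> x \<otimes>\<^bsub>G\<^esub> a) ` (comm_level G A j \<times> A)"

text \<open>
  Words carry the level of each letter, since the same group element may occur at several levels.
  The word \<open>pass_letter G a u\<close> is what remains of \<open>u\<close> after a letter \<open>a\<close> has been moved from its right
  end to its left end.
\<close>

definition pass_letter ::
  "('a, 'b) monoid_scheme \<Rightarrow> 'a \<Rightarrow> (nat \<times> 'a) list \<Rightarrow> (nat \<times> 'a) list" where
  "pass_letter G a u = concat (map (\<lambda>(j, x). [(j, x),
     (Suc j, inv\<^bsub>G\<^esub> x \<otimes>\<^bsub>G\<^esub> inv\<^bsub>G\<^esub> a \<otimes>\<^bsub>G\<^esub> x \<otimes>\<^bsub>G\<^esub> a)]) u)"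

text \<open>
  A letter of level \<open>j\<close> is worth \<open>t powr (-j)\<close>.  A commutator is cheaper than the letter it came from
  by the factor \<open>t\<close>, so moving one letter multiplies the value of a word by at most \<open>1 + 1/t\<close>, and
  moving \<open>t\<close> letters multiplies it by at most \<open>exp 1\<close>.  On the other hand, the number of letters
  of bounded level is at most the value of the word times a power of \<open>t\<close>.
\<close>

definition word_value :: "real \<Rightarrow> (nat \<times> 'a) list \<Rightarrow> real" where
  "word_value t w = (\<Sum>(j, x)\<leftarrow>w. (1 / t) ^ j)"

definition levelled :: "('a, 'b) monoid_scheme \<Rightarrow> 'a set \<Rightarrow> (nat \<times> 'a) list \<Rightarrow> bool" where
  "levelled G A w \<longleftrightarrow> (\<forall>(j, x) \<in> set w. x \<in> comm_level G A j)"

lemma finite_comm_level: "finite A \<Longrightarrow> finite (comm_level G A j)"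
  by (induction j) auto

lemma pass_letter_simps [simp]:
  "pass_letter G a [] = []"
  "pass_letter G a ((j, x) # u) = (j, x) #
     (Suc j, inv\<^bsub>G\<^esub> x \<otimes>\<^bsub>G\<^esub> inv\<^bsub>G\<^esub> a \<otimes>\<^bsub>G\<^esub> x \<otimes>\<^bsub>G\<^esub> a) # pass_letter G a u"
  by (simp_all add: pass_letter_def)

lemma word_value_simps [simp]:
  "word_value t [] = 0"
  "word_value t ((j, x) # u) = (1 / t) ^ j + word_value t u"
  "word_value t (u @ v) = word_value t u + word_value t v"
  by (simp_all add: word_value_def)

lemma word_value_nonneg: "t > 0 \<Longrightarrow> 0 \<le> word_value t w"
  by (induction w) auto

lemma word_value_pass_letter: "word_value t (pass_letter G a u) = (1 + 1 / t) * word_value t u"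
  by (induction u) (auto simp: algebra_simps add_divide_distrib)

lemma pass_letter_level_0:
  "filter (\<lambda>p. fst p = 0) (pass_letter G a u) = filter (\<lambda>p. fst p = 0) u"
  by (induction u) auto

lemma levelled_simps [simp]:
  "levelled G A []"
  "levelled G A ((j, x) # u) \<longleftrightarrow> x \<in> comm_level G A j \<and> levelled G A u"
  "levelled G A (u @ v) \<longleftrightarrow> levelled G A u \<and> levelled G A v"
  by (auto simp: levelled_def)

lemma levelled_pass_letter:
  assumes "a \<in> A" "levelled G A u"
  shows "levelled G A (pass_letter G a u)"
  using assms(2) by (induction u) (use assms(1) in force)+

context group
begin

lemma list_mult_closed: "set w \<subseteq> carrier G \<Longrightarrow> list_mult G w \<in> carrier G"
  by (induction w) auto

lemma list_mult_append:
  "set u \<subseteq> carrier G \<Longrightarrow> set v \<subseteq> carrier G \<Longrightarrow>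
   list_mult G (u @ v) = list_mult G u \<otimes> list_mult G v"
  by (induction u) (auto simp: m_assoc list_mult_closed)

lemma comm_level_closed: "A \<subseteq> carrier G \<Longrightarrow> comm_level G A j \<subseteq> carrier G"
proof (induction j)
  case (Suc j)
  then have "x \<in> carrier G" "a \<in> carrier G" if "x \<in> comm_level G A j" "a \<in> A" for x a
    using that by auto
  then show ?case by auto
qed auto

lemma levelled_closed:
  "A \<subseteq> carrier G \<Longrightarrow> levelled G A w \<Longrightarrow> snd ` set w \<subseteq> carrier G"
proof (rule image_subsetI)
  fix p assume "A \<subseteq> carrier G" "levelled G A w" "p \<in> set w"
  then have "snd p \<in> comm_level G A (fst p)" by (auto simp: levelled_def case_prod_beta)
  then show "snd p \<in> carrier G" using comm_level_closed[OF \<open>A \<subseteq> carrier G\<close>] by blast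
qed

lemma swap_letter:
  assumes "x \<in> carrier G" "a \<in> carrier G"
  shows "x \<otimes> a = a \<otimes> x \<otimes> (inv x \<otimes> inv a \<otimes> x \<otimes> a)"
proof -
  have "a \<otimes> x \<otimes> (inv x \<otimes> inv a \<otimes> x \<otimes> a) = (a \<otimes> x) \<otimes> inv (a \<otimes> x) \<otimes> (x \<otimes> a)"
    using assms by (simp only: inv_mult_group m_assoc m_closed inv_closed)
  then show ?thesis using assms by (simp add: r_inv)
qed

text \<open>
  The relation \<open>x a = a x [x, a]\<close> is applied to each letter \<open>x\<close> of \<open>u\<close> in turn.
\<close>

lemma list_mult_pass_letter:
  assumes "A \<subseteq> carrier G" "a \<in> A" "levelled G A u"
  shows "list_mult G (map snd u) \<otimes> a = a \<otimes> list_mult G (map snd (pass_letter G a u))"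
  using assms(3)
proof (induction u)
  case Nil
  then show ?case using assms by auto
next
  case (Cons p u)
  obtain j x where p: "p = (j, x)" by force
  define c where "c = inv x \<otimes> inv a \<otimes> x \<otimes> a"
  define U where "U = list_mult G (map snd (pass_letter G a u))"
  have a: "a \<in> carrier G" using assms by auto
  have x: "x \<in> carrier G" using Cons.prems p comm_level_closed[OF assms(1)] by auto
  have c: "c \<in> carrier G" using a x by (simp add: c_def)
  have u: "set (map snd u) \<subseteq> carrier G"
    using levelled_closed[OF assms(1), of u] Cons.prems p by auto
  have U: "U \<in> carrier G"
    unfolding U_def
    using levelled_closed[OF assms(1) levelled_pass_letter[OF assms(2)], of u] Cons.prems p
    by (intro list_mult_closed) auto
  have "list_mult G (map snd (p # u)) \<otimes> a = x \<otimes> (list_mult G (map snd u) \<otimes> a)"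
    using a x list_mult_closed[OF u] by (simp add: p m_assoc)
  also have "\<dots> = x \<otimes> (a \<otimes> U)"
    using Cons p by (simp add: U_def)
  also have "\<dots> = (x \<otimes> a) \<otimes> U"
    using a x U by (simp add: m_assoc)
  also have "x \<otimes> a = a \<otimes> x \<otimes> c"
    unfolding c_def by (rule swap_letter[OF x a])
  also have "a \<otimes> x \<otimes> c \<otimes> U = a \<otimes> (x \<otimes> (c \<otimes> U))"
    using a x c U by (simp add: m_assoc)
  finally have "list_mult G (map snd (p # u)) \<otimes> a = a \<otimes> (x \<otimes> (c \<otimes> U))" .
  moreover have "list_mult G (map snd (pass_letter G a (p # u))) = x \<otimes> (c \<otimes> U)"
    unfolding p pass_letter_simps c_def U_def by simp
  ultimately show ?case by (simp only:)
qed

text \<open>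
  The letters of level \<open>0\<close> can be brought to the front in any prescribed order, because each of them
  can be moved to the left past everything before it at the cost of creating letters of positive
  level only.
\<close>

lemma collect_letters:
  assumes A: "A \<subseteq> carrier G" and t: "t > 0"
  shows "levelled G A w \<Longrightarrow> mset (map snd (filter (\<lambda>p. fst p = 0) w)) = mset as \<Longrightarrow>
    \<exists>h. levelled G A h \<and> (\<forall>p\<in>set h. fst p > 0) \<and>
      list_mult G (map snd w) = list_mult G as \<otimes> list_mult G (map snd h) \<and>
      word_value t h \<le> (1 + 1 / t) ^ length as * word_value t w"
proof (induction as arbitrary: w)
  case Nil
  then have "\<forall>p\<in>set w. fst p > 0" by (auto simp: filter_empty_conv)
  moreover have "list_mult G (map snd w) \<in> carrier G"
    using levelled_closed[OF A Nil(1)] by (intro list_mult_closed) auto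
  ultimately show ?case using Nil by (intro exI[of _ w]) auto
next
  case (Cons a as)
  have "a \<in># mset (map snd (filter (\<lambda>p. fst p = 0) w))"
    by (simp only: Cons.prems(2)) simp
  then have "(0, a) \<in> set w" by (auto simp: image_iff)
  then obtain u v where w: "w = u @ (0, a) # v" by (meson split_list)
  define w' where "w' = pass_letter G a u @ v"
  have lev: "levelled G A u" "levelled G A v" and aA: "a \<in> A"
    using Cons.prems(1) by (auto simp: w)
  have lev': "levelled G A w'"
    using lev levelled_pass_letter[OF aA] by (auto simp: w'_def)
  have "mset (map snd (filter (\<lambda>p. fst p = 0) w')) = mset as"
    using Cons.prems(2) by (simp add: w w'_def pass_letter_level_0)
  from Cons.IH[OF lev' this] obtain h where h: "levelled G A h" "\<forall>p\<in>set h. fst p > 0"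
    "list_mult G (map snd w') = list_mult G as \<otimes> list_mult G (map snd h)"
    "word_value t h \<le> (1 + 1 / t) ^ length as * word_value t w'"
    by blast
  have aG: "a \<in> carrier G" using aA A by auto
  have asA: "set as \<subseteq> A"
  proof -
    have "set as \<subseteq> set_mset (mset (a # as))" by auto
    also have "\<dots> \<subseteq> A"
      unfolding Cons.prems(2)[symmetric] using Cons.prems(1) by (auto simp: levelled_def)
    finally show ?thesis .
  qed
  have cl: "set (map snd u) \<subseteq> carrier G" "set (map snd v) \<subseteq> carrier G"
    "set (map snd (pass_letter G a u)) \<subseteq> carrier G" "set (map snd h) \<subseteq> carrier G"
    "set as \<subseteq> carrier G"
    using levelled_closed[OF A] lev levelled_pass_letter[OF aA] h(1) asA A by auto
  note cl' = cl[THEN list_mult_closed]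
  have "list_mult G (map snd w) =
      (list_mult G (map snd u) \<otimes> a) \<otimes> list_mult G (map snd v)"
    using cl cl' aG by (simp add: w list_mult_append m_assoc)
  also have "\<dots> = a \<otimes> list_mult G (map snd w')"
    using cl cl' aG by (simp add: w'_def list_mult_append list_mult_pass_letter[OF A aA lev(1)] m_assoc)
  also have "\<dots> = list_mult G (a # as) \<otimes> list_mult G (map snd h)"
    using cl' aG by (simp add: h(3) m_assoc)
  finally have eq: "list_mult G (map snd w) = list_mult G (a # as) \<otimes> list_mult G (map snd h)" .
  have "word_value t w' \<le> (1 + 1 / t) * word_value t w"
    using t word_value_nonneg[OF t, of v] by (simp add: w w'_def word_value_pass_letter algebra_simps)
  then have "(1 + 1 / t) ^ length as * word_value t w' \<le>
      (1 + 1 / t) ^ length as * ((1 + 1 / t) * word_value t w)"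
    using t by (intro mult_left_mono) auto
  then have "word_value t h \<le> (1 + 1 / t) ^ length (a # as) * word_value t w"
    using h(4) by (simp add: algebra_simps)
  with h eq show ?case by blast
qed

lemma lower_central_subgroup: "subgroup (lower_central G k) G"
proof (induction k)
  case 0
  then show ?case by (simp add: subgroup_self)
next
  case (Suc k)
  then show ?case
    using subgroup.subset[OF Suc]
    by (auto simp: commutator_subgroup_def intro!: generate_is_subgroup)
qed

lemma comm_level_lower_central:
  assumes "A \<subseteq> lower_central G k"
  shows "comm_level G A j \<subseteq> lower_central G (k + j)"
proof (induction j)
  case (Suc j)
  show ?case
  proof clarsimp
    fix x a assume x: "x \<in> comm_level G A j" and a: "a \<in> A"
    have xin: "inv x \<in> lower_central G (k + j)" "x \<in> carrier G"
      using Suc x subgroup.m_inv_closed[OF lower_central_subgroup]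
        subgroup.mem_carrier[OF lower_central_subgroup] by auto
    have ain: "a \<in> carrier G"
      using a assms subgroup.mem_carrier[OF lower_central_subgroup] by auto
    have "inv x \<otimes> inv a \<otimes> inv (inv x) \<otimes> inv (inv a)
        \<in> commutator_subgroup G (lower_central G (k + j)) (carrier G)"
      unfolding commutator_subgroup_def using xin ain by (intro generate.incl) blast
    then show "inv x \<otimes> inv a \<otimes> x \<otimes> a
        \<in> commutator_subgroup G (lower_central G (k + j)) (carrier G)"
      using xin ain by simp
  qed
qed (use assms in auto)

text \<open>
  A commutator \<open>[x, a]\<close> with \<open>a\<close> in the \<open>k\<close>-th term lies in the next term wherever \<open>x\<close> comes from,
  being the inverse of a commutator whose first entry is \<open>a\<close>.
\<close>

lemma comm_level_next_term:
  assumes "A \<subseteq> lower_central G k"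
  shows "comm_level G A (Suc j) \<subseteq> lower_central G (Suc k)"
proof clarsimp
  fix x a assume x: "x \<in> comm_level G A j" and a: "a \<in> A"
  have A: "A \<subseteq> carrier G"
    using assms subgroup.subset[OF lower_central_subgroup] by blast
  have xin: "x \<in> carrier G" using x comm_level_closed[OF A] by auto
  have ain: "a \<in> carrier G" "inv a \<in> lower_central G k"
    using a A assms subgroup.m_inv_closed[OF lower_central_subgroup] by auto
  have sub: "subgroup (commutator_subgroup G (lower_central G k) (carrier G)) G"
    using lower_central_subgroup[of "Suc k"] by simp
  have "inv a \<otimes> inv x \<otimes> inv (inv a) \<otimes> inv (inv x)
      \<in> commutator_subgroup G (lower_central G k) (carrier G)"
    unfolding commutator_subgroup_def using xin ain by (intro generate.incl) blast
  from subgroup.m_inv_closed[OF sub this]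
  show "inv x \<otimes> inv a \<otimes> x \<otimes> a \<in> commutator_subgroup G (lower_central G k) (carrier G)"
    using xin ain(1) by (simp add: inv_mult_group m_assoc)
qed

lemma lower_central_trivial_above:
  assumes "lower_central G N = {\<one>}"
  shows "lower_central G (N + i) = {\<one>}"
proof (induction i)
  case (Suc i)
  have "{h \<otimes> k \<otimes> inv h \<otimes> inv k |h k. h \<in> {\<one>} \<and> k \<in> carrier G} = {\<one>}"
    by (auto intro!: exI[of _ \<one>])
  then show ?case using Suc by (simp add: commutator_subgroup_def generate_one)
qed (use assms in auto)

end

text \<open>
  A multiset over \<open>A\<close> is determined by its multiplicities, which form a function from \<open>A\<close> to \<open>{..n}\<close>.
\<close>

lemma card_multisets_bounded:
  assumes "finite A"
  shows "finite {M. set_mset M \<subseteq> A \<and> size M \<le> n}"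
    and "card {M. set_mset M \<subseteq> A \<and> size M \<le> n} \<le> (n + 1) ^ card A"
proof -
  let ?F = "\<lambda>M. restrict (count M) A"
  have inj: "inj_on ?F {M. set_mset M \<subseteq> A \<and> size M \<le> n}"
  proof (rule inj_onI)
    fix M N assume *: "M \<in> {M. set_mset M \<subseteq> A \<and> size M \<le> n}"
      "N \<in> {M. set_mset M \<subseteq> A \<and> size M \<le> n}" "?F M = ?F N"
    show "M = N"
    proof (rule multiset_eqI)
      fix x
      show "count M x = count N x"
      proof (cases "x \<in> A")
        case True
        then show ?thesis using fun_cong[OF *(3), of x] by simp
      next
        case False
        then have "x \<notin># M" "x \<notin># N" using * by auto
        then show ?thesis by (simp add: not_in_iff)
      qed
    qed
  qed
  have sub: "?F ` {M. set_mset M \<subseteq> A \<and> size M \<le> n} \<subseteq> (A \<rightarrow>\<^sub>E {..n})"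
    by (auto intro: order_trans[OF count_le_size])
  have fin: "finite (A \<rightarrow>\<^sub>E {..n})" by (intro finite_PiE assms) auto
  show "finite {M. set_mset M \<subseteq> A \<and> size M \<le> n}"
    using finite_imageD[OF finite_subset[OF sub fin] inj] .
  have "card {M. set_mset M \<subseteq> A \<and> size M \<le> n} = card (?F ` {M. set_mset M \<subseteq> A \<and> size M \<le> n})"
    by (simp add: card_image[OF inj])
  also have "\<dots> \<le> card (A \<rightarrow>\<^sub>E {..n})" by (rule card_mono[OF fin sub])
  also have "\<dots> = (n + 1) ^ card A" by (simp add: card_PiE assms)
  finally show "card {M. set_mset M \<subseteq> A \<and> size M \<le> n} \<le> (n + 1) ^ card A" .
qed

lemma finite_word_ball:
  assumes "finite A"
  shows "finite (word_ball G A n)"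
proof -
  have "word_ball G A n = list_mult G ` {w. set w \<subseteq> A \<and> length w \<le> n}"
    by (auto simp: word_ball_def)
  then show ?thesis using finite_lists_length_le[OF assms] by simp
qed

lemma one_plus_inverse_power_le_3:
  assumes "l \<le> n" "n > 0"
  shows "(1 + 1 / real n) ^ l \<le> 3"
proof -
  have "(1 + 1 / real n) ^ l \<le> (1 + 1 / real n) ^ n"
    using assms by (intro power_increasing) auto
  also have "\<dots> \<le> exp (1 / real n) ^ n"
    by (intro power_mono) auto
  also have "\<dots> = exp 1" using assms by (simp add: exp_of_nat_mult[symmetric])
  also have "\<dots> \<le> 3" by (rule exp_le)
  finally show ?thesis .
qed

context group
begin

text \<open>
  A word of length \<open>n\<close> is rewritten as its letters in an order that depends only on their multiset,
  followed by a word in commutators.  The first factor takes polynomially many values, and the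
  second one is a word of polynomial length in elements of the next term of the lower central
  series.  The value of letters is taken at \<open>t = n + 1\<close>, and letters of level at least \<open>m\<close> are
  trivial and can be dropped.
\<close>

lemma word_ball_subset_collected:
  assumes A: "A \<subseteq> carrier G" "A \<subseteq> lower_central G k" and N: "lower_central G (k + m) = {\<one>}"
  defines "B \<equiv> (\<Union>j\<in>{1..<m}. comm_level G A j)"
  shows "word_ball G A n \<subseteq> (\<lambda>(M, h). list_mult G (SOME as. mset as = M) \<otimes> h) `
    ({M. set_mset M \<subseteq> A \<and> size M \<le> n} \<times> word_ball G B (3 * (n + 1) ^ (m + 1)))"
proof
  fix g assume "g \<in> word_ball G A n"
  then obtain w where w: "set w \<subseteq> A" "length w \<le> n" "g = list_mult G w"
    by (auto simp: word_ball_def)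
  define as where "as = (SOME as. mset as = mset w)"
  have as: "mset as = mset w" unfolding as_def by (rule someI[of _ w]) simp
  \<comment> \<open>\<open>n + 1\<close> rather than \<open>n\<close>, to keep \<open>t\<close> positive when \<open>n = 0\<close>\<close>
  define t where "t = real (n + 1)"
  have t: "t > 0" "t \<ge> 1" by (auto simp: t_def)
  let ?w = "map (\<lambda>x. (0::nat, x)) w"
  have "levelled G A ?w" using w by (auto simp: levelled_def)
  moreover have "mset (map snd (filter (\<lambda>p. fst p = 0) ?w)) = mset as"
    by (simp add: as filter_map o_def)
  ultimately obtain h where h: "levelled G A h" "\<forall>p\<in>set h. fst p > 0"
    "list_mult G (map snd ?w) = list_mult G as \<otimes> list_mult G (map snd h)"
    "word_value t h \<le> (1 + 1 / t) ^ length as * word_value t ?w"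
    using collect_letters[OF A(1) t(1)] by blast
  have "word_value t ?w = real (length w)"
    by (induction w) auto
  moreover have "(1 + 1 / t) ^ length as \<le> 3"
    unfolding t_def using w(2) mset_eq_length[OF as] by (intro one_plus_inverse_power_le_3) auto
  ultimately have val: "word_value t h \<le> 3 * t"
    using h(4) w(2) by (elim order_trans) (intro mult_mono, auto simp: t_def)
  define h' where "h' = filter (\<lambda>p. fst p < m) h"
  have prod: "list_mult G (map snd h') = list_mult G (map snd h)"
    unfolding h'_def using h(1)
  proof (induction h)
    case (Cons p h)
    obtain j x where p: "p = (j, x)" by force
    have cl: "list_mult G (map snd h) \<in> carrier G"
      using levelled_closed[OF A(1), of h] Cons.prems by (intro list_mult_closed) (auto simp: p)
    show ?case
    proof (cases "j < m")
      case False
      then have "x \<in> lower_central G (k + m + (j - m))"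
        using comm_level_lower_central[OF A(2), of j] Cons.prems by (auto simp: p)
      then have "x = \<one>" using lower_central_trivial_above[OF N] by blast
      then show ?thesis using False Cons cl by (simp add: p)
    qed (use Cons p in auto)
  qed simp
  have "real (length h') \<le> t ^ m * word_value t h"
    unfolding h'_def
  proof (induction h)
    case (Cons p h)
    obtain j x where p: "p = (j, x)" by force
    have nn: "0 \<le> t ^ m * (1 / t) ^ j" using t by simp
    have "1 \<le> t ^ m * (1 / t) ^ j" if "j < m"
    proof -
      have "t ^ m * (1 / t) ^ j = t ^ (m - j)"
        using that t by (simp add: power_diff power_one_over field_simps)
      then show ?thesis using t by simp
    qed
    with Cons.IH nn show ?case by (auto simp: p algebra_simps)
  qed simp
  also have "\<dots> \<le> t ^ m * (3 * t)" using val t by (intro mult_left_mono) auto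
  also have "\<dots> = real (3 * (n + 1) ^ (m + 1))" by (simp add: t_def algebra_simps)
  finally have len: "length h' \<le> 3 * (n + 1) ^ (m + 1)" by linarith
  have "set (map snd h') \<subseteq> B"
    using h(1,2) by (fastforce simp: B_def h'_def levelled_def)
  then have "list_mult G (map snd h') \<in> word_ball G B (3 * (n + 1) ^ (m + 1))"
    using len by (auto simp: word_ball_def intro!: exI[of _ "map snd h'"])
  moreover have "mset w \<in> {M. set_mset M \<subseteq> A \<and> size M \<le> n}" using w by auto
  moreover have "g = list_mult G as \<otimes> list_mult G (map snd h')"
    using h(3) w(3) by (simp add: prod o_def)
  ultimately show "g \<in> (\<lambda>(M, h). list_mult G (SOME as. mset as = M) \<otimes> h) `
    ({M. set_mset M \<subseteq> A \<and> size M \<le> n} \<times> word_ball G B (3 * (n + 1) ^ (m + 1)))"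
    by (intro image_eqI[of _ _ "(mset w, list_mult G (map snd h'))"]) (auto simp: as_def)
qed

text \<open>
  Downward induction along the lower central series; the statement speaks about arbitrary finite
  subsets of a term instead of generating sets, so that the commutators produced by the collection
  can serve as the alphabet of the next step.
\<close>

lemma nilpotent_polynomial_growth_lower_central:
  assumes N: "lower_central G N = {\<one>}" and "k \<le> N"
  shows "finite A \<Longrightarrow> A \<subseteq> lower_central G k \<Longrightarrow> \<exists>C D. \<forall>n. card (word_ball G A n) \<le> C * (n + 1) ^ D"
  using \<open>k \<le> N\<close>
proof (induction k arbitrary: A rule: inc_induct)
  case base
  have "list_mult G w = \<one>" if "set w \<subseteq> A" for w
    using that base N by (induction w) auto
  then have "word_ball G A n \<subseteq> {\<one>}" for n by (auto simp: word_ball_def)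
  then have "card (word_ball G A n) \<le> 1 * (n + 1) ^ 0" for n
    using card_mono[of "{\<one>}" "word_ball G A n"] by simp
  then show ?case by blast
next
  case (step k)
  define m where "m = N - k"
  define B where "B = (\<Union>j\<in>{1..<m}. comm_level G A j)"
  have A: "A \<subseteq> carrier G"
    using step.prems(2) subgroup.subset[OF lower_central_subgroup] by blast
  have "comm_level G A j \<subseteq> lower_central G (Suc k)" if "j \<ge> 1" for j
    using that comm_level_next_term[OF step.prems(2), of "j - 1"] by (cases j) auto
  then have "B \<subseteq> lower_central G (Suc k)"
    unfolding B_def by (intro UN_least) (simp del: lower_central.simps)
  moreover have finB: "finite B" using finite_comm_level[OF step.prems(1)] by (auto simp: B_def)
  ultimately obtain C D where CD: "\<And>n. card (word_ball G B n) \<le> C * (n + 1) ^ D"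
    using step.IH by blast
  have "card (word_ball G A n) \<le> (C * 4 ^ D) * (n + 1) ^ (card A + (m + 1) * D)" for n
  proof -
    let ?Ms = "{M. set_mset M \<subseteq> A \<and> size M \<le> n}"
    let ?W = "word_ball G B (3 * (n + 1) ^ (m + 1))"
    have "lower_central G (k + m) = {\<one>}" using step.hyps N by (simp add: m_def)
    note sub = word_ball_subset_collected[OF A step.prems(2) this, of n, folded B_def]
    have fin: "finite (?Ms \<times> ?W)"
      using card_multisets_bounded(1)[OF step.prems(1)] finite_word_ball[OF finB] by blast
    have "card (word_ball G A n) \<le> card (?Ms \<times> ?W)"
      by (rule order_trans[OF card_mono[OF finite_imageI[OF fin] sub] card_image_le[OF fin]])
    also have "\<dots> = card ?Ms * card ?W" by (rule card_cartesian_product)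
    also have "\<dots> \<le> (n + 1) ^ card A * (C * (3 * (n + 1) ^ (m + 1) + 1) ^ D)"
      by (intro mult_mono card_multisets_bounded step.prems CD) auto
    also have "\<dots> \<le> (n + 1) ^ card A * (C * (4 * (n + 1) ^ (m + 1)) ^ D)"
    proof -
      have "1 \<le> (n + 1) ^ (m + 1)" by (rule one_le_power) simp
      then show ?thesis by (intro mult_left_mono power_mono) auto
    qed
    also have "\<dots> = (C * 4 ^ D) * (n + 1) ^ (card A + (m + 1) * D)"
    proof -
      have "(4 * (n + 1) ^ (m + 1)) ^ D = 4 ^ D * (n + 1) ^ ((m + 1) * D)"
        by (simp only: power_mult_distrib power_mult)
      then show ?thesis by (simp only: power_add[of _ "card A"] mult_ac)
    qed
    finally show ?thesis .
  qed
  then show ?case by blast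
qed

lemma nilpotent_polynomial_growth:
  assumes "nilpotent_group G" "finite A" "A \<subseteq> carrier G"
  obtains C D where "\<And>n. card (word_ball G A n) \<le> C * (n + 1) ^ D"
proof -
  obtain N where "lower_central G N = {\<one>}" using assms(1) by (auto simp: nilpotent_group_def)
  from nilpotent_polynomial_growth_lower_central[OF this, of 0 A] show ?thesis
    using assms(2,3) that by fastforce
qed

end

section \<open>Exponential decay of Green functions\<close>

text \<open>
  The quadratic form of a symmetric nonnegative kernel is bounded by its largest row sum, by
  \<open>2 v x v y \<le> (v x)\<^sup>2 + (v y)\<^sup>2\<close>.
\<close>

lemma Schur_test:
  fixes K :: "'a \<Rightarrow> 'a \<Rightarrow> real"
  assumes "finite V" and sym: "\<And>x y. x \<in> V \<Longrightarrow> y \<in> V \<Longrightarrow> K x y = K y x"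
    and nonneg: "\<And>x y. x \<in> V \<Longrightarrow> y \<in> V \<Longrightarrow> 0 \<le> K x y"
    and row: "\<And>x. x \<in> V \<Longrightarrow> (\<Sum>y\<in>V. K x y) \<le> \<kappa>"
  shows "(\<Sum>x\<in>V. \<Sum>y\<in>V. K x y * v x * v y) \<le> \<kappa> * (\<Sum>x\<in>V. (v x)\<^sup>2)"
proof -
  have swap: "(\<Sum>x\<in>V. \<Sum>y\<in>V. K x y * (v y)\<^sup>2) = (\<Sum>x\<in>V. \<Sum>y\<in>V. K x y * (v x)\<^sup>2)"
    by (subst sum.swap) (intro sum.cong refl, simp add: sym)
  have "(\<Sum>x\<in>V. \<Sum>y\<in>V. K x y * v x * v y) \<le>
      (\<Sum>x\<in>V. \<Sum>y\<in>V. (K x y * (v x)\<^sup>2 + K x y * (v y)\<^sup>2) / 2)"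
  proof (intro sum_mono)
    fix x y assume "x \<in> V" "y \<in> V"
    have "K x y * (v x * v y) \<le> K x y * (((v x)\<^sup>2 + (v y)\<^sup>2) / 2)"
      using sum_squares_bound[of "v x" "v y"] nonneg[OF \<open>x \<in> V\<close> \<open>y \<in> V\<close>]
      by (intro mult_left_mono) auto
    then show "K x y * v x * v y \<le> (K x y * (v x)\<^sup>2 + K x y * (v y)\<^sup>2) / 2"
      by (simp add: algebra_simps)
  qed
  also have "\<dots> = (\<Sum>x\<in>V. \<Sum>y\<in>V. K x y * (v x)\<^sup>2)"
    by (simp add: sum_divide_distrib[symmetric] sum.distrib swap)
  also have "\<dots> = (\<Sum>x\<in>V. (\<Sum>y\<in>V. K x y) * (v x)\<^sup>2)"
    by (simp add: sum_distrib_right)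
  also have "\<dots> \<le> (\<Sum>x\<in>V. \<kappa> * (v x)\<^sup>2)"
    by (intro sum_mono mult_right_mono row) auto
  finally show ?thesis by (simp add: sum_distrib_left)
qed

text \<open>
  Set \<open>v x = exp (s \<cdot> d x) \<cdot> u x\<close> and test the inequality for \<open>u\<close> against \<open>v\<close>.  The kernel of the
  conjugated operator is \<open>K x y \<cdot> exp (s (d x - d y))\<close>; exchanging \<open>x\<close> and \<open>y\<close> in its quadratic form
  replaces the exponential by a hyperbolic cosine.  With the bound \<open>\<kappa>\<close> for the symmetrised rows,
  the squared \<open>\<ell>\<^sup>2\<close>-norm \<open>E\<close> of \<open>v\<close> satisfies \<open>(1 - q\<kappa>) E \<le> v c \<cdot> exp (s \<cdot> d c)\<close>, and \<open>v c \<le> sqrt E\<close>.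
  It suffices that \<open>u\<close> is a subsolution of the resolvent equation, so truncated Green functions
  are admitted.
\<close>

lemma Combes_Thomas:
  fixes K :: "'a \<Rightarrow> 'a \<Rightarrow> real" and d u :: "'a \<Rightarrow> real"
  assumes V: "finite V" "c \<in> V" "z \<in> V"
    and sym: "\<And>x y. x \<in> V \<Longrightarrow> y \<in> V \<Longrightarrow> K x y = K y x"
    and nonneg: "\<And>x y. x \<in> V \<Longrightarrow> y \<in> V \<Longrightarrow> 0 \<le> K x y"
    and row: "\<And>x. x \<in> V \<Longrightarrow> (\<Sum>y\<in>V. K x y * cosh (s * (d x - d y))) \<le> \<kappa>"
    and lam: "0 \<le> q" "q * \<kappa> < 1"
    and u: "\<And>x. x \<in> V \<Longrightarrow> 0 \<le> u x"
      "\<And>x. x \<in> V \<Longrightarrow> u x \<le> of_bool (x = c) + q * (\<Sum>y\<in>V. K x y * u y)"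
  shows "u z \<le> exp (s * (d c - d z)) / (1 - q * \<kappa>)"
proof -
  define v where "v = (\<lambda>x. exp (s * d x) * u x)"
  define E where "E = (\<Sum>x\<in>V. (v x)\<^sup>2)"
  define Q where "Q = (\<Sum>x\<in>V. \<Sum>y\<in>V. K x y * exp (s * (d x - d y)) * v x * v y)"
  have v: "0 \<le> v x" if "x \<in> V" for x using u(1)[OF that] by (simp add: v_def)
  have vE: "v x \<le> sqrt E" if "x \<in> V" for x
    unfolding E_def using that V(1) by (intro real_le_rsqrt member_le_sum) auto
  have E0: "0 \<le> E" by (simp add: E_def sum_nonneg)
  \<comment> \<open>symmetrisation turns the exponential weight into a hyperbolic cosine\<close>
  have Q: "Q \<le> \<kappa> * E"
  proof -
    have "Q = (\<Sum>x\<in>V. \<Sum>y\<in>V. K x y * exp (s * (d y - d x)) * v x * v y)"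
      unfolding Q_def by (subst sum.swap) (intro sum.cong refl, simp add: sym mult_ac)
    then have "Q + Q = (\<Sum>x\<in>V. \<Sum>y\<in>V. K x y * exp (s * (d x - d y)) * v x * v y +
        K x y * exp (s * (d y - d x)) * v x * v y)"
      by (simp add: Q_def sum.distrib)
    also have "\<dots> = (\<Sum>x\<in>V. \<Sum>y\<in>V. 2 * ((K x y * cosh (s * (d x - d y))) * v x * v y))"
    proof (intro sum.cong refl)
      fix x y
      have "s * (d y - d x) = - (s * (d x - d y))" by (simp add: algebra_simps)
      then show "K x y * exp (s * (d x - d y)) * v x * v y +
        K x y * exp (s * (d y - d x)) * v x * v y =
        2 * ((K x y * cosh (s * (d x - d y))) * v x * v y)"
        by (simp add: cosh_field_def field_simps)
    qed
    also have "\<dots> = 2 * (\<Sum>x\<in>V. \<Sum>y\<in>V. (K x y * cosh (s * (d x - d y))) * v x * v y)"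
      by (simp add: sum_distrib_left)
    also have "(\<Sum>x\<in>V. \<Sum>y\<in>V. (K x y * cosh (s * (d x - d y))) * v x * v y) \<le> \<kappa> * E"
      unfolding E_def
    proof (rule Schur_test[OF V(1)])
      fix x y assume "x \<in> V" "y \<in> V"
      have "cosh (s * (d x - d y)) = cosh (s * (d y - d x))"
        by (subst cosh_minus[symmetric]) (simp add: algebra_simps)
      then show "K x y * cosh (s * (d x - d y)) = K y x * cosh (s * (d y - d x))"
        using sym \<open>x \<in> V\<close> \<open>y \<in> V\<close> by simp
      show "0 \<le> K x y * cosh (s * (d x - d y))"
        using nonneg[OF \<open>x \<in> V\<close> \<open>y \<in> V\<close>] by simp
    qed (rule row)
    finally show ?thesis by simp
  qed
  have "E \<le> (\<Sum>x\<in>V. v x * exp (s * d x) * (of_bool (x = c) + q * (\<Sum>y\<in>V. K x y * u y)))"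
    unfolding E_def
  proof (rule sum_mono)
    fix x assume x: "x \<in> V"
    have "(v x)\<^sup>2 = v x * exp (s * d x) * u x" by (simp add: v_def power2_eq_square)
    also have "\<dots> \<le> v x * exp (s * d x) * (of_bool (x = c) + q * (\<Sum>y\<in>V. K x y * u y))"
      using v[OF x] by (intro mult_left_mono u x) auto
    finally show "(v x)\<^sup>2 \<le> \<dots>" .
  qed
  also have "\<dots> = (\<Sum>x\<in>V. if x = c then v c * exp (s * d c) else 0) +
      q * (\<Sum>x\<in>V. \<Sum>y\<in>V. v x * exp (s * d x) * (K x y * u y))"
    unfolding sum_distrib_left sum.distrib[symmetric]
    by (intro sum.cong refl) (auto simp: algebra_simps sum_distrib_left)
  also have "(\<Sum>x\<in>V. if x = c then v c * exp (s * d c) else 0) = v c * exp (s * d c)"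
    using V by simp
  also have "(\<Sum>x\<in>V. \<Sum>y\<in>V. v x * exp (s * d x) * (K x y * u y)) = Q"
    unfolding Q_def
  proof (intro sum.cong refl)
    fix x y
    have "exp (s * d x) = exp (s * (d x - d y)) * exp (s * d y)"
      by (simp add: exp_add[symmetric] algebra_simps)
    then show "v x * exp (s * d x) * (K x y * u y) = K x y * exp (s * (d x - d y)) * v x * v y"
      by (simp add: v_def)
  qed
  also have "v c * exp (s * d c) + q * Q \<le> sqrt E * exp (s * d c) + q * (\<kappa> * E)"
    using vE[OF V(2)] Q lam by (intro add_mono mult_right_mono mult_left_mono) auto
  finally have "(1 - q * \<kappa>) * E \<le> sqrt E * exp (s * d c)"
    by (simp add: algebra_simps)
  then have *: "sqrt E * ((1 - q * \<kappa>) * sqrt E) \<le> sqrt E * exp (s * d c)"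
  proof -
    have "sqrt E * ((1 - q * \<kappa>) * sqrt E) = (1 - q * \<kappa>) * (sqrt E * sqrt E)"
      by (simp only: mult_ac)
    also have "sqrt E * sqrt E = E" using E0 by simp
    finally show ?thesis using \<open>(1 - q * \<kappa>) * E \<le> _\<close> by (simp only:)
  qed
  have "(1 - q * \<kappa>) * sqrt E \<le> exp (s * d c)"
  proof (cases "E = 0")
    case False
    then show ?thesis using * E0 by (simp add: mult_le_cancel_left_pos)
  qed simp
  then have "v z \<le> exp (s * d c) / (1 - q * \<kappa>)"
  proof -
    have "(1 - q * \<kappa>) * v z \<le> (1 - q * \<kappa>) * sqrt E"
      using vE[OF V(3)] lam by (intro mult_left_mono) auto
    with \<open>(1 - q * \<kappa>) * sqrt E \<le> _\<close> have "v z * (1 - q * \<kappa>) \<le> exp (s * d c)"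
      by (simp add: mult.commute)
    then show ?thesis using lam by (simp add: pos_le_divide_eq)
  qed
  then have "exp (- (s * d z)) * v z \<le> exp (- (s * d z)) * (exp (s * d c) / (1 - q * \<kappa>))"
    by (rule mult_left_mono) simp
  moreover have "exp (- (s * d z)) * v z = u z" by (simp add: v_def exp_minus)
  moreover have "exp (- (s * d z)) * (exp (s * d c) / (1 - q * \<kappa>)) =
      exp (s * (d c - d z)) / (1 - q * \<kappa>)"
    by (simp add: exp_add[symmetric] algebra_simps)
  ultimately show ?thesis by (simp only:)
qed

section \<open>Word length\<close>

locale fg_group = group G for G :: "('a, 'b) monoid_scheme" (structure) +
  fixes A :: "'a set"
  assumes finite_gens: "finite A" and symmetric_gens: "symmetric_generating_set G A"
begin

abbreviation len :: "'a \<Rightarrow> nat" where "len \<equiv> word_length G A"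

definition len_ball :: "nat \<Rightarrow> 'a set" where "len_ball n = {g \<in> carrier G. len g \<le> n}"

lemma gens_closed: "A \<subseteq> carrier G"
  and gens_inv: "a \<in> A \<Longrightarrow> inv a \<in> A"
  and gens_generate: "generate G A = carrier G"
  using symmetric_gens by (auto simp: symmetric_generating_set_def)

lemma ex_word:
  assumes "g \<in> carrier G"
  shows "\<exists>w. set w \<subseteq> A \<and> list_mult G w = g"
proof -
  have "g \<in> generate G A" using assms gens_generate by simp
  then show ?thesis
  proof (induction g rule: generate.induct)
    case one
    then show ?case by (intro exI[of _ "[]"]) simp
  next
    case (incl a)
    then show ?case using gens_closed by (intro exI[of _ "[a]"]) auto
  next
    case (inv a)
    then show ?case using gens_closed gens_inv by (intro exI[of _ "[inv a]"]) auto
  next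
    case (eng g h)
    then obtain u v where "set u \<subseteq> A" "list_mult G u = g" "set v \<subseteq> A" "list_mult G v = h" by blast
    then show ?case using gens_closed by (intro exI[of _ "u @ v"]) (auto simp: list_mult_append)
  qed
qed

lemma word_of_len:
  assumes "g \<in> carrier G"
  obtains w where "set w \<subseteq> A" "length w = len g" "list_mult G w = g"
proof -
  have "\<exists>n w. set w \<subseteq> A \<and> length w = n \<and> list_mult G w = g"
    using ex_word[OF assms] by blast
  from LeastI_ex[OF this] show ?thesis using that unfolding word_length_def by blast
qed

lemma len_le: "set w \<subseteq> A \<Longrightarrow> len (list_mult G w) \<le> length w"
  unfolding word_length_def by (rule Least_le) blast

lemma len_one [simp]: "len \<one> = 0"
  using len_le[of "[]"] by simp

lemma len_mult:
  assumes "g \<in> carrier G" "h \<in> carrier G"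
  shows "len (g \<otimes> h) \<le> len g + len h"
proof -
  obtain u v where "set u \<subseteq> A" "length u = len g" "list_mult G u = g"
    "set v \<subseteq> A" "length v = len h" "list_mult G v = h"
    using word_of_len assms by metis
  then show ?thesis using len_le[of "u @ v"] gens_closed by (auto simp: list_mult_append)
qed

lemma len_inv_le:
  assumes "g \<in> carrier G"
  shows "len (inv g) \<le> len g"
proof -
  obtain w where w: "set w \<subseteq> A" "length w = len g" "list_mult G w = g"
    using word_of_len assms by metis
  have "list_mult G (rev (map (m_inv G) w)) = inv (list_mult G w)" using w(1)
  proof (induction w)
    case (Cons a w)
    then have "a \<in> carrier G" "list_mult G w \<in> carrier G" "set (rev (map (m_inv G) w)) \<subseteq> carrier G"
      using gens_closed by (auto intro!: list_mult_closed)
    then show ?case using Cons by (simp add: list_mult_append inv_mult_group)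
  qed simp
  moreover have "set (rev (map (m_inv G) w)) \<subseteq> A" using w(1) gens_inv by auto
  ultimately show ?thesis using len_le[of "rev (map (m_inv G) w)"] w by simp
qed

lemma len_inv [simp]: "g \<in> carrier G \<Longrightarrow> len (inv g) = len g"
  using len_inv_le[of g] len_inv_le[of "inv g"] by simp

lemma len_diff:
  assumes "x \<in> carrier G" "y \<in> carrier G"
  shows "\<bar>real (len x) - real (len y)\<bar> \<le> real (len (x \<otimes> inv y))"
proof -
  have "len x \<le> len (x \<otimes> inv y) + len y"
    using len_mult[of "x \<otimes> inv y" y] assms by (simp add: m_assoc)
  moreover have "inv (x \<otimes> inv y) \<otimes> x = y"
    using assms by (simp add: inv_mult_group m_assoc)
  then have "len y \<le> len (x \<otimes> inv y) + len x"
    using len_mult[of "inv (x \<otimes> inv y)" x] assms by simp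
  ultimately show ?thesis by linarith
qed

lemma len_ball_eq_word_ball: "len_ball n = word_ball G A n"
proof (intro equalityI subsetI)
  fix g assume g: "g \<in> len_ball n"
  then obtain w where "set w \<subseteq> A" "length w = len g" "list_mult G w = g"
    using word_of_len[of g] by (auto simp: len_ball_def)
  then show "g \<in> word_ball G A n"
    using g by (auto simp: len_ball_def word_ball_def intro!: exI[of _ w])
next
  fix g assume "g \<in> word_ball G A n"
  then obtain w where w: "g = list_mult G w" "set w \<subseteq> A" "length w \<le> n"
    by (auto simp: word_ball_def)
  then show "g \<in> len_ball n"
    using len_le[OF w(2)] list_mult_closed[of w] gens_closed by (simp add: len_ball_def)
qed

lemma finite_len_ball: "finite (len_ball n)"
  by (simp add: len_ball_eq_word_ball finite_word_ball finite_gens)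

lemma len_ballI: "g \<in> carrier G \<Longrightarrow> len g \<le> n \<Longrightarrow> g \<in> len_ball n"
  and len_ballD: "g \<in> len_ball n \<Longrightarrow> g \<in> carrier G" "g \<in> len_ball n \<Longrightarrow> len g \<le> n"
  and len_ball_closed: "len_ball n \<subseteq> carrier G"
  by (auto simp: len_ball_def)

lemma countable_carrier: "countable (carrier G)"
proof -
  have "countable (\<Union>n. len_ball n)"
    by (rule countable_UN) (auto intro: countable_finite finite_len_ball)
  moreover have "carrier G = (\<Union>n. len_ball n)" by (auto simp: len_ball_def)
  ultimately show ?thesis by simp
qed

section \<open>Convolution powers of a symmetric measure\<close>

primrec conv_power :: "'a set \<Rightarrow> ('a \<Rightarrow> real) \<Rightarrow> nat \<Rightarrow> 'a \<Rightarrow> real" where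
  "conv_power F \<nu> 0 x = of_bool (x = \<one>)"
| "conv_power F \<nu> (Suc k) x = (\<Sum>g\<in>F. \<nu> g * conv_power F \<nu> k (inv g \<otimes> x))"

lemma conv_power_nonneg:
  assumes "\<And>g. g \<in> F \<Longrightarrow> 0 \<le> \<nu> g"
  shows "0 \<le> conv_power F \<nu> k x"
  by (induction k arbitrary: x) (auto intro!: sum_nonneg mult_nonneg_nonneg assms)

lemma conv_power_support:
  "x \<in> carrier G \<Longrightarrow> len x > n * k \<Longrightarrow> conv_power (len_ball n) \<nu> k x = 0"
proof (induction k arbitrary: x)
  case 0
  then show ?case by auto
next
  case (Suc k)
  have "conv_power (len_ball n) \<nu> k (inv g \<otimes> x) = 0" if g: "g \<in> len_ball n" for g
  proof (rule Suc.IH)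
    have gc: "g \<in> carrier G" "len g \<le> n" using g len_ballD by auto
    show "inv g \<otimes> x \<in> carrier G" using gc Suc.prems by simp
    have "len x = len (g \<otimes> (inv g \<otimes> x))" using gc Suc.prems by (simp add: m_assoc[symmetric])
    also have "\<dots> \<le> len g + len (inv g \<otimes> x)" using gc Suc.prems by (intro len_mult) auto
    finally show "len (inv g \<otimes> x) > n * k" using gc Suc.prems by simp
  qed
  then show ?case by simp
qed

text \<open>
  Convolution as a matrix: the convolution powers up to the \<open>m\<close>-th one live on the ball of radius
  \<open>n * m\<close>, so that a single finite index set serves for all of them.
\<close>

lemma conv_power_Suc_kernel:
  assumes "x \<in> carrier G" "k < m"
  shows "conv_power (len_ball n) \<nu> (Suc k) x =
    (\<Sum>y\<in>len_ball (n * m). (if x \<otimes> inv y \<in> len_ball n then \<nu> (x \<otimes> inv y) else 0)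
       * conv_power (len_ball n) \<nu> k y)"
proof -
  let ?p = "conv_power (len_ball n) \<nu> k"
  let ?V = "len_ball (n * m)"
  let ?U = "(\<lambda>g. inv g \<otimes> x) ` len_ball n"
  let ?f = "\<lambda>y. (if x \<otimes> inv y \<in> len_ball n then \<nu> (x \<otimes> inv y) else 0) * ?p y"
  have recover: "x \<otimes> inv (inv g \<otimes> x) = g" if "g \<in> carrier G" for g
    using that assms by (simp add: inv_mult_group m_assoc[symmetric])
  have recover_inv: "inv (x \<otimes> inv y) \<otimes> x = y" if "y \<in> carrier G" for y
    using that assms by (simp add: inv_mult_group m_assoc)
  have "inj_on (\<lambda>g. inv g \<otimes> x) (len_ball n)"
    by (rule inj_on_inverseI[of _ "\<lambda>y. x \<otimes> inv y"]) (use recover len_ballD in blast)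
  then have "(\<Sum>y\<in>?U. ?f y) = (\<Sum>g\<in>len_ball n. ?f (inv g \<otimes> x))"
    by (simp add: sum.reindex)
  also have "\<dots> = (\<Sum>g\<in>len_ball n. \<nu> g * ?p (inv g \<otimes> x))"
    by (intro sum.cong refl) (use recover len_ballD in auto)
  finally have 1: "conv_power (len_ball n) \<nu> (Suc k) x = (\<Sum>y\<in>?U. ?f y)" by simp
  have U: "?U \<subseteq> carrier G" using assms len_ballD by auto
  have k: "n * k \<le> n * m" using assms by simp
  have "(\<Sum>y\<in>?U. ?f y) = (\<Sum>y\<in>?U \<inter> ?V. ?f y)"
  proof (rule sum.mono_neutral_right)
    show "\<forall>y\<in>?U - ?U \<inter> ?V. ?f y = 0"
    proof
      fix y assume y: "y \<in> ?U - ?U \<inter> ?V"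
      then have "len y > n * m" "y \<in> carrier G" using U by (auto simp: len_ball_def)
      then have "?p y = 0" using le_less_trans[OF k] by (intro conv_power_support)
      then show "?f y = 0" by simp
    qed
  qed (auto simp: finite_len_ball)
  also have "\<dots> = (\<Sum>y\<in>?V. ?f y)"
  proof (rule sum.mono_neutral_left)
    show "\<forall>y\<in>?V - ?U \<inter> ?V. ?f y = 0"
    proof
      fix y assume y: "y \<in> ?V - ?U \<inter> ?V"
      have "x \<otimes> inv y \<notin> len_ball n"
      proof
        assume "x \<otimes> inv y \<in> len_ball n"
        then have "inv (x \<otimes> inv y) \<otimes> x \<in> ?U" by blast
        then show False using y recover_inv len_ballD(1)[of y] by auto
      qed
      then show "?f y = 0" by simp
    qed
  qed (auto simp: finite_len_ball)
  finally show ?thesis using 1 by simp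
qed

text \<open>
  The truncated Green function \<open>\<Sum>k\<le>m. q ^ k * conv_power k\<close> dominates \<open>q ^ m * conv_power m\<close> and is a
  subsolution of the resolvent equation.  The row condition of the Combes--Thomas estimate holds
  because \<open>\<bar>|x| - |y|\<bar> \<le> |x y\<inverse>|\<close>.  Passing through the Green function avoids any norm estimate for
  powers of the non-symmetric conjugated operator, for which the first-order terms in \<open>s\<close> need
  not cancel.
\<close>

lemma conv_power_le_Green:
  fixes \<nu> :: "'a \<Rightarrow> real"
  assumes nonneg: "\<And>g. g \<in> carrier G \<Longrightarrow> 0 \<le> \<nu> g"
    and sym: "\<And>g. g \<in> carrier G \<Longrightarrow> \<nu> (inv g) = \<nu> g"
    and \<kappa>: "(\<Sum>g\<in>len_ball n. \<nu> g * cosh (s * real (len g))) \<le> \<kappa>"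
    and s: "0 \<le> s" and lam: "0 < q" "q * \<kappa> < 1" and m: "m > 0"
    and z: "z \<in> len_ball (n * m)"
  shows "conv_power (len_ball n) \<nu> m z \<le> exp (- s * real (len z)) / (q ^ m * (1 - q * \<kappa>))"
proof -
  let ?p = "conv_power (len_ball n) \<nu>"
  define K where "K = (\<lambda>x y. if x \<otimes> inv y \<in> len_ball n then \<nu> (x \<otimes> inv y) else 0)"
  define u where "u = (\<lambda>x. \<Sum>k\<le>m. q ^ k * ?p k x)"
  have p: "0 \<le> ?p k x" for k x
    by (intro conv_power_nonneg nonneg len_ballD)
  have flip: "inv (x \<otimes> inv y) = y \<otimes> inv x" if "x \<in> carrier G" "y \<in> carrier G" for x y
    using that by (simp add: inv_mult_group)
  have "u z \<le> exp (s * (real (len \<one>) - real (len z))) / (1 - q * \<kappa>)"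
  proof (rule Combes_Thomas[where K = K and V = "len_ball (n * m)"])
    show "\<one> \<in> len_ball (n * m)" by (intro len_ballI) auto
    fix x assume x: "x \<in> len_ball (n * m)"
    then have xc: "x \<in> carrier G" by (rule len_ballD)
    show "0 \<le> u x" unfolding u_def using lam p by (intro sum_nonneg mult_nonneg_nonneg) auto
    have "u x = of_bool (x = \<one>) + (\<Sum>k<m. q ^ Suc k * ?p (Suc k) x)"
      unfolding u_def using sum.atMost_shift[of "\<lambda>k. q ^ k * ?p k x" m] by simp
    also have "(\<Sum>k<m. q ^ Suc k * ?p (Suc k) x) =
        (\<Sum>k<m. q ^ Suc k * (\<Sum>y\<in>len_ball (n * m). K x y * ?p k y))"
      unfolding K_def
      by (intro sum.cong refl arg_cong2[where f = "(*)"] conv_power_Suc_kernel xc) simp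
    also have "\<dots> = q * (\<Sum>y\<in>len_ball (n * m). K x y * (\<Sum>k<m. q ^ k * ?p k y))"
      unfolding sum_distrib_left
      by (subst sum.swap) (intro sum.cong refl, simp add: mult_ac)
    also have "\<dots> \<le> q * (\<Sum>y\<in>len_ball (n * m). K x y * u y)"
    proof (intro mult_left_mono sum_mono)
      fix y
      show "(\<Sum>k<m. q ^ k * ?p k y) \<le> u y"
        unfolding u_def using p lam by (intro sum_mono2) auto
      assume "y \<in> len_ball (n * m)"
      then show "0 \<le> K x y" unfolding K_def using nonneg xc len_ballD by auto
    qed (use lam in auto)
    finally show "u x \<le> of_bool (x = \<one>) + q * (\<Sum>y\<in>len_ball (n * m). K x y * u y)" by simp
    show "(\<Sum>y\<in>len_ball (n * m). K x y * cosh (s * (real (len x) - real (len y)))) \<le> \<kappa>"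
    proof -
      have inj: "inj_on (\<lambda>y. x \<otimes> inv y) (len_ball (n * m))"
        by (rule inj_on_inverseI[of _ "\<lambda>g. inv g \<otimes> x"])
          (use xc len_ballD in \<open>auto simp: inv_mult_group m_assoc\<close>)
      define L where "L = (\<lambda>g. (if g \<in> len_ball n then \<nu> g else 0) * cosh (s * real (len g)))"
      have "(\<Sum>y\<in>len_ball (n * m). K x y * cosh (s * (real (len x) - real (len y)))) \<le>
          (\<Sum>y\<in>len_ball (n * m). L (x \<otimes> inv y))"
      proof (rule sum_mono)
        fix y assume y: "y \<in> len_ball (n * m)"
        have yc: "y \<in> carrier G" using y by (rule len_ballD)
        have "cosh (s * (real (len x) - real (len y))) =
            cosh (s * \<bar>real (len x) - real (len y)\<bar>)"
          by (subst cosh_real_abs[symmetric]) (simp only: abs_mult abs_of_nonneg[OF s])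
        also have "\<dots> \<le> cosh (s * real (len (x \<otimes> inv y)))"
          using len_diff[OF xc yc] s by (subst cosh_real_nonneg_le_iff) (auto intro: mult_left_mono)
        finally show "K x y * cosh (s * (real (len x) - real (len y))) \<le> L (x \<otimes> inv y)"
          unfolding K_def L_def using nonneg xc yc by (intro mult_left_mono) auto
      qed
      also have "\<dots> = (\<Sum>g\<in>(\<lambda>y. x \<otimes> inv y) ` len_ball (n * m). L g)"
        by (simp add: sum.reindex[OF inj])
      also have "\<dots> \<le> (\<Sum>g\<in>(\<lambda>y. x \<otimes> inv y) ` len_ball (n * m) \<union> len_ball n. L g)"
        using nonneg len_ballD by (intro sum_mono2) (auto simp: L_def finite_len_ball)
      also have "\<dots> = (\<Sum>g\<in>len_ball n. L g)"
        by (rule sum.mono_neutral_right) (auto simp: L_def finite_len_ball)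
      also have "\<dots> = (\<Sum>g\<in>len_ball n. \<nu> g * cosh (s * real (len g)))"
        by (simp add: L_def)
      finally show ?thesis using \<kappa> by simp
    qed
    fix y assume "y \<in> len_ball (n * m)"
    then have yc: "y \<in> carrier G" by (rule len_ballD)
    show "K x y = K y x"
      unfolding K_def using sym[of "x \<otimes> inv y"] flip[OF xc yc] xc yc len_inv[of "x \<otimes> inv y"]
      by (auto simp: len_ball_def)
    show "0 \<le> K x y" unfolding K_def using nonneg xc yc by auto
  qed (use lam z finite_len_ball in auto)
  moreover have "q ^ m * ?p m z \<le> u z"
    unfolding u_def using p lam by (intro member_le_sum) auto
  ultimately have "q ^ m * ?p m z \<le> exp (- s * real (len z)) / (1 - q * \<kappa>)" by simp
  then show ?thesis using lam by (simp add: field_simps)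
qed

end

section \<open>Moments of a law with tail \<open>1 / (r log r)\<close>\<close>

lemma cosh_le_one_plus_square:
  fixes x :: real
  assumes "0 \<le> x" "x \<le> 1"
  shows "cosh x \<le> 1 + x\<^sup>2"
proof -
  have low: "1 + x + x\<^sup>2 / 2 \<le> exp x" using assms by (intro exp_lower_Taylor_quadratic)
  have pos: "0 < 1 + x + x\<^sup>2 / 2" using assms by (simp add: add_pos_nonneg)
  have "1 \<le> (1 - x + x\<^sup>2) * (1 + x + x\<^sup>2 / 2)"
  proof -
    have "(1 - x + x\<^sup>2) * (1 + x + x\<^sup>2 / 2) = 1 + x\<^sup>2 / 2 + x ^ 3 / 2 + x ^ 4 / 2"
      by (simp add: field_simps power2_eq_square power3_eq_cube power4_eq_xxxx)
    then show ?thesis using assms by simp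
  qed
  also have "\<dots> \<le> (1 - x + x\<^sup>2) * exp x"
    using assms by (intro mult_left_mono low) (simp add: add_increasing2)
  finally have "exp (- x) \<le> 1 - x + x\<^sup>2"
    by (simp add: exp_minus field_simps)
  moreover have "exp x \<le> 1 + x + x\<^sup>2" by (rule exp_bound[OF assms])
  ultimately show ?thesis by (simp add: cosh_field_def)
qed

lemma exp_minus_cosh_le_1:
  fixes x :: real
  assumes "0 \<le> x"
  shows "exp (- x) * cosh x \<le> 1"
proof -
  have "cosh x \<le> exp x" using assms by (simp add: cosh_field_def)
  then have "exp (- x) * cosh x \<le> exp (- x) * exp x" by (intro mult_left_mono) auto
  then show ?thesis by (simp add: exp_add[symmetric])
qed

lemma sum_inverse_squares_le:
  assumes "1 \<le> n" "n \<le> N"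
  shows "(\<Sum>r\<in>{n<..N}. 1 / (real r)\<^sup>2) \<le> 1 / real n - 1 / real N"
  using assms(2)
proof (induction N rule: dec_induct)
  case (step N)
  have "{n<..Suc N} = insert (Suc N) {n<..N}" using step.hyps by auto
  moreover have "1 / (real (Suc N))\<^sup>2 \<le> 1 / real N - 1 / real (Suc N)"
  proof -
    have N: "0 < real N" using step.hyps assms(1) by simp
    have "1 / (real (Suc N))\<^sup>2 \<le> 1 / (real N * real (Suc N))"
      unfolding power2_eq_square using N by (intro divide_left_mono mult_right_mono) auto
    also have "\<dots> = 1 / real N - 1 / real (Suc N)" using N by (simp add: field_simps)
    finally show ?thesis .
  qed
  ultimately show ?case using step.IH by simp
qed simp

lemma sum_inverse_le_ln:
  assumes "1 \<le> R" "R \<le> n"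
  shows "(\<Sum>r\<in>{R<..n}. 1 / real r) \<le> ln (real n / real R)"
  using assms(2)
proof (induction n rule: dec_induct)
  case base
  then show ?case using assms by simp
next
  case (step n)
  have "{R<..Suc n} = insert (Suc n) {R<..n}" using step.hyps by auto
  moreover have "1 / real (Suc n) \<le> ln (real (Suc n) / real R) - ln (real n / real R)"
  proof -
    have "ln (real n / real (Suc n)) \<le> real n / real (Suc n) - 1"
      using step.hyps assms(1) by (intro ln_le_minus_one) auto
    then show ?thesis using step.hyps assms(1) by (simp add: ln_div field_simps)
  qed
  ultimately show ?case using step.IH by simp
qed

locale sphere_tail_law = fg_group G A
  for G :: "('a, 'b) monoid_scheme" (structure) and A :: "'a set" +
  fixes \<mu> :: "'a measure" and r\<^sub>0 :: nat and c :: real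
  assumes prob_\<mu>: "prob_space \<mu>" and sets_\<mu>: "sets \<mu> = sets (count_space (carrier G))"
    and symmetric_\<mu>: "symmetric_measure G \<mu>"
    and r\<^sub>0: "3 \<le> r\<^sub>0" and c: "0 < c"
    and sphere_upper: "\<And>r. r\<^sub>0 \<le> r \<Longrightarrow>
      (\<Sum>g | g \<in> carrier G \<and> len g = r. measure \<mu> {g}) \<le> c / ((real r)\<^sup>2 * ln (real r))"
begin

sublocale \<mu>: prob_space \<mu> by (rule prob_\<mu>)

definition sphere_mass :: "nat \<Rightarrow> real" where
  "sphere_mass r = (\<Sum>g | g \<in> carrier G \<and> len g = r. measure \<mu> {g})"

lemma sets_\<mu>_iff: "B \<in> sets \<mu> \<longleftrightarrow> B \<subseteq> carrier G"
  by (simp add: sets_\<mu>)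

lemma measure_finite_set: "finite B \<Longrightarrow> B \<subseteq> carrier G \<Longrightarrow> measure \<mu> B = (\<Sum>g\<in>B. measure \<mu> {g})"
  by (rule \<mu>.finite_measure_eq_sum_singleton) (auto simp: sets_\<mu>_iff)

lemma sum_shells:
  fixes f :: "nat \<Rightarrow> real"
  assumes "finite T"
  shows "(\<Sum>g | g \<in> carrier G \<and> len g \<in> T. f (len g) * measure \<mu> {g}) = (\<Sum>r\<in>T. f r * sphere_mass r)"
proof -
  let ?B = "{g \<in> carrier G. len g \<in> T}"
  have "finite ?B"
    by (rule finite_subset[OF _ finite_len_ball[of "Max T"]]) (use assms in \<open>auto simp: len_ball_def\<close>)
  then have "(\<Sum>g\<in>?B. f (len g) * measure \<mu> {g}) =
      (\<Sum>r\<in>T. \<Sum>g | g \<in> ?B \<and> len g = r. f (len g) * measure \<mu> {g})"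
    using assms by (intro sum.group[symmetric]) auto
  also have "\<dots> = (\<Sum>r\<in>T. f r * sphere_mass r)"
    unfolding sphere_mass_def sum_distrib_left by (intro sum.cong refl) auto
  finally show ?thesis .
qed

lemma sphere_mass_nonneg: "0 \<le> sphere_mass r"
  by (simp add: sphere_mass_def sum_nonneg)

lemma sphere_mass_le: "r\<^sub>0 \<le> r \<Longrightarrow> sphere_mass r \<le> c / ((real r)\<^sup>2 * ln (real r))"
  unfolding sphere_mass_def by (rule sphere_upper)

lemma sum_sphere_mass_le_1: "finite T \<Longrightarrow> (\<Sum>r\<in>T. sphere_mass r) \<le> 1"
proof -
  assume T: "finite T"
  have fin: "finite {g \<in> carrier G. len g \<in> T}"
    by (rule finite_subset[OF _ finite_len_ball[of "Max T"]]) (use T in \<open>auto simp: len_ball_def\<close>)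
  have "(\<Sum>r\<in>T. sphere_mass r) = measure \<mu> {g \<in> carrier G. len g \<in> T}"
    using sum_shells[OF T, of "\<lambda>_. 1"] measure_finite_set[OF fin] by simp
  then show ?thesis by simp
qed

lemma ln_ge_1: "r\<^sub>0 \<le> r \<Longrightarrow> 1 \<le> ln (real r)"
proof -
  assume "r\<^sub>0 \<le> r"
  then have "exp 1 \<le> real r" using exp_le r\<^sub>0 by linarith
  then have "ln (exp 1) \<le> ln (real r)" by (subst ln_le_cancel_iff) (use r\<^sub>0 \<open>r\<^sub>0 \<le> r\<close> in auto)
  then show ?thesis by simp
qed

text \<open>
  The radii below \<open>r\<^sub>0\<close> contribute at most \<open>r\<^sub>0\<^sup>2\<close> in total, each other radius at most \<open>c / log r \<le> c\<close>.
\<close>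

lemma truncated_second_moment:
  assumes "1 \<le> R"
  shows "(\<Sum>g\<in>len_ball R. (real (len g))\<^sup>2 * measure \<mu> {g}) \<le> ((real r\<^sub>0)\<^sup>2 + c) * real R"
proof -
  have "(\<Sum>g\<in>len_ball R. (real (len g))\<^sup>2 * measure \<mu> {g}) = (\<Sum>r\<le>R. (real r)\<^sup>2 * sphere_mass r)"
    using sum_shells[of "{..R}" "\<lambda>r. (real r)\<^sup>2"] by (simp add: len_ball_def)
  also have "\<dots> \<le> (\<Sum>r\<le>R. (real r\<^sub>0)\<^sup>2 * sphere_mass r + (if r = 0 then 0 else c))"
  proof (rule sum_mono)
    fix r
    show "(real r)\<^sup>2 * sphere_mass r \<le> (real r\<^sub>0)\<^sup>2 * sphere_mass r + (if r = 0 then 0 else c)"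
    proof (cases "r < r\<^sub>0")
      case True
      then have "(real r)\<^sup>2 * sphere_mass r \<le> (real r\<^sub>0)\<^sup>2 * sphere_mass r"
        by (intro mult_right_mono sphere_mass_nonneg power_mono) auto
      then show ?thesis using c by auto
    next
      case False
      then have r: "r\<^sub>0 \<le> r" "0 < real r" using r\<^sub>0 by auto
      have "(real r)\<^sup>2 * sphere_mass r \<le> (real r)\<^sup>2 * (c / ((real r)\<^sup>2 * ln (real r)))"
        by (intro mult_left_mono sphere_mass_le r) auto
      also have "\<dots> = c / ln (real r)" using r by simp
      also have "\<dots> \<le> c / 1" using ln_ge_1[OF r(1)] c by (intro divide_left_mono) auto
      finally show ?thesis using r sphere_mass_nonneg[of r] by (simp add: add_increasing)
    qed
  qed
  also have "\<dots> = (real r\<^sub>0)\<^sup>2 * (\<Sum>r\<le>R. sphere_mass r) + real R * c"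
  proof -
    have "(\<Sum>r\<le>R. if r = 0 then 0 else c) = real R * c" by (simp add: sum.atMost_shift)
    then show ?thesis by (simp add: sum.distrib sum_distrib_left)
  qed
  also have "\<dots> \<le> (real r\<^sub>0)\<^sup>2 * real R + real R * c"
    using order_trans[OF sum_sphere_mass_le_1[of "{..R}"], of "real R"] assms
    by (intro add_right_mono mult_left_mono) auto
  finally show ?thesis by (simp add: algebra_simps)
qed

text \<open>
  This is where the choice of \<open>R\<close> matters: the sum of \<open>1 / (r log r)\<close> over \<open>R < r \<le> n\<close> is small as soon
  as \<open>log (n / R)\<close> is small compared with \<open>log R\<close>.
\<close>

lemma middle_first_moment:
  assumes "r\<^sub>0 \<le> R" "R \<le> n"
  shows "(\<Sum>g | g \<in> carrier G \<and> len g \<in> {R<..n}. real (len g) * measure \<mu> {g})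
    \<le> c * ln (real n / real R) / ln (real R)"
proof -
  have "(\<Sum>g | g \<in> carrier G \<and> len g \<in> {R<..n}. real (len g) * measure \<mu> {g}) =
      (\<Sum>r\<in>{R<..n}. real r * sphere_mass r)"
    by (rule sum_shells) simp
  also have "\<dots> \<le> (\<Sum>r\<in>{R<..n}. c / ln (real R) * (1 / real r))"
  proof (rule sum_mono)
    fix r assume "r \<in> {R<..n}"
    then have r: "R \<le> r" "r\<^sub>0 \<le> r" "0 < real r" using assms by auto
    have "real r * sphere_mass r \<le> real r * (c / ((real r)\<^sup>2 * ln (real r)))"
      by (intro mult_left_mono sphere_mass_le r) auto
    also have "\<dots> = c / ln (real r) * (1 / real r)" using r by (simp add: power2_eq_square)
    also have "\<dots> \<le> c / ln (real R) * (1 / real r)"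
      using ln_ge_1[OF assms(1)] ln_ge_1[OF r(2)] c r assms(1) r\<^sub>0
      by (intro mult_right_mono divide_left_mono) (auto simp: ln_le_cancel_iff)
    finally show "real r * sphere_mass r \<le> \<dots>" .
  qed
  also have "\<dots> = c / ln (real R) * (\<Sum>r\<in>{R<..n}. 1 / real r)" by (simp add: sum_distrib_left)
  also have "\<dots> \<le> c / ln (real R) * ln (real n / real R)"
    using ln_ge_1[OF assms(1)] c assms r\<^sub>0 by (intro mult_left_mono sum_inverse_le_ln) auto
  finally show ?thesis by simp
qed

lemma tail_le:
  assumes "r\<^sub>0 \<le> n"
  shows "measure \<mu> {g \<in> carrier G. n < len g} \<le> c / (real n * ln (real n))"
proof -
  let ?B = "\<lambda>N. {g \<in> carrier G. len g \<in> {n<..N}}"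
  have fin: "finite (?B N)" for N
    by (rule finite_subset[OF _ finite_len_ball[of N]]) (auto simp: len_ball_def)
  have "(\<Union>N. ?B N) = {g \<in> carrier G. n < len g}" by auto
  moreover have "(\<lambda>N. measure \<mu> (?B N)) \<longlonglongrightarrow> measure \<mu> (\<Union>N. ?B N)"
  proof (rule Lim_measure_incseq)
    show "range ?B \<subseteq> sets \<mu>" by (auto simp: sets_\<mu>_iff)
    show "incseq ?B" by (auto simp: incseq_def)
  qed simp
  ultimately have lim: "(\<lambda>N. measure \<mu> (?B N)) \<longlonglongrightarrow> measure \<mu> {g \<in> carrier G. n < len g}"
    by (simp only:)
  show ?thesis
  proof (rule LIMSEQ_le_const2[OF lim], intro exI allI impI)
    fix N assume N: "n \<le> N"
    have "measure \<mu> (?B N) = (\<Sum>r\<in>{n<..N}. sphere_mass r)"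
      using sum_shells[of "{n<..N}" "\<lambda>_. 1"] measure_finite_set[OF fin] by simp
    also have "\<dots> \<le> (\<Sum>r\<in>{n<..N}. c / ln (real n) * (1 / (real r)\<^sup>2))"
    proof (rule sum_mono)
      fix r assume "r \<in> {n<..N}"
      then have r: "n \<le> r" "r\<^sub>0 \<le> r" "0 < real r" using assms by auto
      have "sphere_mass r \<le> c / ((real r)\<^sup>2 * ln (real r))" by (rule sphere_mass_le[OF r(2)])
      also have "\<dots> = c / ln (real r) * (1 / (real r)\<^sup>2)" by simp
      also have "\<dots> \<le> c / ln (real n) * (1 / (real r)\<^sup>2)"
        using ln_ge_1[OF assms(1)] ln_ge_1[OF r(2)] c r assms(1) r\<^sub>0
        by (intro mult_right_mono divide_left_mono) (auto simp: ln_le_cancel_iff)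
      finally show "sphere_mass r \<le> \<dots>" .
    qed
    also have "\<dots> = c / ln (real n) * (\<Sum>r\<in>{n<..N}. 1 / (real r)\<^sup>2)"
      by (simp only: sum_distrib_left)
    also have "\<dots> \<le> c / ln (real n) * (1 / real n - 1 / real N)"
      using ln_ge_1[OF assms(1)] c assms N r\<^sub>0 by (intro mult_left_mono sum_inverse_squares_le) auto
    also have "\<dots> \<le> c / ln (real n) * (1 / real n)"
      using ln_ge_1[OF assms(1)] c by (intro mult_left_mono) auto
    finally show "measure \<mu> (?B N) \<le> c / (real n * ln (real n))" by (simp add: mult.commute)
  qed
qed

text \<open>
  Long steps are penalised at the same exponential rate \<open>s\<close> at which decay is to be proved.
\<close>

definition damped :: "nat \<Rightarrow> real \<Rightarrow> 'a \<Rightarrow> real" where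
  "damped R s g = measure \<mu> {g} * (if len g \<le> R then 1 else exp (- s * real (len g)))"

lemma damped_nonneg: "0 \<le> damped R s g"
  by (simp add: damped_def)

lemma damped_inv: "g \<in> carrier G \<Longrightarrow> damped R s (inv g) = damped R s g"
proof -
  assume g: "g \<in> carrier G"
  then have "measure \<mu> {inv g} = measure \<mu> {g}"
    using symmetric_\<mu> unfolding symmetric_measure_def by (metis (no_types))
  then show ?thesis using g by (simp only: damped_def len_inv)
qed

text \<open>
  Damped long steps contribute no more than their mass, since \<open>exp (-y) cosh y \<le> 1\<close>, and short ones
  exceed their mass by at most \<open>s\<^sup>2\<close> times the truncated second moment, since \<open>cosh y \<le> 1 + y\<^sup>2\<close> for \<open>y \<le> 1\<close>.
\<close>

lemma damped_cosh_le:
  assumes "1 \<le> R" "R \<le> n" "0 \<le> s" "s * real R \<le> 1"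
  shows "(\<Sum>g\<in>len_ball n. damped R s g * cosh (s * real (len g))) \<le>
    1 + s\<^sup>2 * (((real r\<^sub>0)\<^sup>2 + c) * real R)"
proof -
  have "(\<Sum>g\<in>len_ball n. damped R s g * cosh (s * real (len g))) \<le>
      (\<Sum>g\<in>len_ball n. measure \<mu> {g} +
        (if g \<in> len_ball R then s\<^sup>2 * ((real (len g))\<^sup>2 * measure \<mu> {g}) else 0))"
  proof (rule sum_mono)
    fix g assume g: "g \<in> len_ball n"
    show "damped R s g * cosh (s * real (len g)) \<le> measure \<mu> {g} +
        (if g \<in> len_ball R then s\<^sup>2 * ((real (len g))\<^sup>2 * measure \<mu> {g}) else 0)"
    proof (cases "len g \<le> R")
      case True
      have "s * real (len g) \<le> s * real R" using True assms by (intro mult_left_mono) auto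
      then have "measure \<mu> {g} * cosh (s * real (len g)) \<le>
          measure \<mu> {g} * (1 + (s * real (len g))\<^sup>2)"
        using assms by (intro mult_left_mono cosh_le_one_plus_square) auto
      then show ?thesis using True g by (simp add: damped_def len_ball_def algebra_simps)
    next
      case False
      have "measure \<mu> {g} * (exp (- (s * real (len g))) * cosh (s * real (len g))) \<le> measure \<mu> {g} * 1"
        using assms by (intro mult_left_mono exp_minus_cosh_le_1) auto
      then show ?thesis using False by (simp add: damped_def len_ball_def mult_ac)
    qed
  qed
  also have "\<dots> = measure \<mu> (len_ball n) +
      s\<^sup>2 * (\<Sum>g\<in>len_ball R. (real (len g))\<^sup>2 * measure \<mu> {g})"
  proof -
    have "len_ball n \<inter> len_ball R = len_ball R" using assms by (auto simp: len_ball_def)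
    then show ?thesis
      by (simp add: sum.distrib measure_finite_set[OF finite_len_ball len_ball_closed]
          sum_distrib_left sum.inter_restrict[symmetric] finite_len_ball)
  qed
  also have "\<dots> \<le> 1 + s\<^sup>2 * (((real r\<^sub>0)\<^sup>2 + c) * real R)"
    by (intro add_mono mult_left_mono truncated_second_moment assms) auto
  finally show ?thesis .
qed

section \<open>Convolution powers as sums over paths\<close>

lemma conv_power_eq_sum_lists:
  assumes "finite F" "F \<subseteq> carrier G"
  shows "x \<in> carrier G \<Longrightarrow> conv_power F \<nu> k x =
    (\<Sum>gs | set gs \<subseteq> F \<and> length gs = k \<and> list_mult G gs = x. prod_list (map \<nu> gs))"
proof (induction k arbitrary: x)
  case 0
  have "{gs. set gs \<subseteq> F \<and> length gs = 0 \<and> list_mult G gs = x} = (if x = \<one> then {[]} else {})"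
    by auto
  then show ?case by simp
next
  case (Suc k)
  let ?L = "\<lambda>y. {gs. set gs \<subseteq> F \<and> length gs = k \<and> list_mult G gs = y}"
  have fin: "finite (?L y)" for y
    by (rule finite_subset[OF _ finite_lists_length_eq[OF assms(1), of k]]) auto
  have move: "g \<otimes> h = x \<longleftrightarrow> h = inv g \<otimes> x" if "g \<in> carrier G" "h \<in> carrier G" for g h
    using that Suc.prems by (metis inv_solve_left)
  have eq: "{gs. set gs \<subseteq> F \<and> length gs = Suc k \<and> list_mult G gs = x} =
      (\<lambda>(g, gs). g # gs) ` (SIGMA g:F. ?L (inv g \<otimes> x))" (is "?l = ?r")
  proof (intro equalityI subsetI)
    fix ws assume "ws \<in> ?l"
    then obtain g gs where ws: "ws = g # gs" "g \<in> F" "set gs \<subseteq> F" "length gs = k" "g \<otimes> list_mult G gs = x"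
      by (cases ws) auto
    then have "list_mult G gs = inv g \<otimes> x"
      using move[of g "list_mult G gs"] assms(2) list_mult_closed[of gs] by auto
    then show "ws \<in> ?r" using ws by auto
  next
    fix ws assume "ws \<in> ?r"
    then obtain g gs where ws: "ws = g # gs" "g \<in> F" "set gs \<subseteq> F" "length gs = k"
      "list_mult G gs = inv g \<otimes> x" by auto
    then have "g \<otimes> list_mult G gs = x"
      using move[of g "list_mult G gs"] assms(2) list_mult_closed[of gs] by auto
    then show "ws \<in> ?l" using ws by auto
  qed
  have inj: "inj_on (\<lambda>(g, gs). g # gs) (SIGMA g:F. ?L (inv g \<otimes> x))" by (auto simp: inj_on_def)
  have "(\<Sum>gs | set gs \<subseteq> F \<and> length gs = Suc k \<and> list_mult G gs = x. prod_list (map \<nu> gs)) =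
      (\<Sum>(g, gs)\<in>(SIGMA g:F. ?L (inv g \<otimes> x)). \<nu> g * prod_list (map \<nu> gs))"
    unfolding eq by (subst sum.reindex[OF inj]) (simp add: case_prod_unfold)
  also have "\<dots> = (\<Sum>g\<in>F. \<Sum>gs\<in>?L (inv g \<otimes> x). \<nu> g * prod_list (map \<nu> gs))"
    by (rule sum.Sigma[symmetric]) (use assms fin in auto)
  also have "\<dots> = (\<Sum>g\<in>F. \<nu> g * conv_power F \<nu> k (inv g \<otimes> x))"
    using Suc assms(2) by (intro sum.cong refl) (auto simp: sum_distrib_left)
  finally show ?case by simp
qed

lemma sum_lists_le_conv_power:
  assumes "finite F" "F \<subseteq> carrier G" and nonneg: "\<And>g. 0 \<le> \<nu> g" and V: "finite V" "V \<subseteq> carrier G"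
    and T: "\<And>gs. gs \<in> T \<Longrightarrow> set gs \<subseteq> F \<and> length gs = k \<and> list_mult G gs \<in> V"
  shows "(\<Sum>gs\<in>T. prod_list (map \<nu> gs)) \<le> (\<Sum>x\<in>V. conv_power F \<nu> k x)"
proof -
  let ?U = "{gs. set gs \<subseteq> F \<and> length gs = k}"
  have fin: "finite ?U" by (rule finite_lists_length_eq[OF assms(1)])
  have pn: "0 \<le> prod_list (map \<nu> gs)" for gs
    by (induction gs) (auto intro: mult_nonneg_nonneg nonneg)
  have "(\<Sum>gs\<in>T. prod_list (map \<nu> gs)) \<le> (\<Sum>gs\<in>{gs \<in> ?U. list_mult G gs \<in> V}. prod_list (map \<nu> gs))"
  proof (rule sum_mono2)
    show "finite {gs \<in> ?U. list_mult G gs \<in> V}" by (rule finite_subset[OF _ fin]) auto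
  qed (use T pn in auto)
  also have "\<dots> = (\<Sum>x\<in>V. \<Sum>gs | gs \<in> {gs \<in> ?U. list_mult G gs \<in> V} \<and> list_mult G gs = x. prod_list (map \<nu> gs))"
    using finite_subset[OF _ fin, of "{gs \<in> ?U. list_mult G gs \<in> V}"] V
    by (intro sum.group[symmetric]) auto
  also have "\<dots> = (\<Sum>x\<in>V. conv_power F \<nu> k x)"
  proof (intro sum.cong refl)
    fix x assume "x \<in> V"
    then have "{gs. gs \<in> {gs \<in> ?U. list_mult G gs \<in> V} \<and> list_mult G gs = x} =
      {gs. set gs \<subseteq> F \<and> length gs = k \<and> list_mult G gs = x}" by auto
    then show "(\<Sum>gs | gs \<in> {gs \<in> ?U. list_mult G gs \<in> V} \<and> list_mult G gs = x. prod_list (map \<nu> gs)) =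
        conv_power F \<nu> k x"
      using conv_power_eq_sum_lists[OF assms(1,2), of x] \<open>x \<in> V\<close> V by auto
  qed
  finally show ?thesis .
qed

definition long_part :: "nat \<Rightarrow> 'a list \<Rightarrow> real" where
  "long_part R gs = (\<Sum>g\<leftarrow>gs. if R < len g then real (len g) else 0)"

lemma prod_list_damped:
  "prod_list (map (\<lambda>g. measure \<mu> {g}) gs) = exp (s * long_part R gs) * prod_list (map (damped R s) gs)"
proof (induction gs)
  case (Cons g gs)
  have "measure \<mu> {g} = exp (s * (if R < len g then real (len g) else 0)) * damped R s g"
    by (auto simp: damped_def exp_minus)
  then show ?case using Cons by (simp add: long_part_def distrib_left exp_add)
qed (simp add: long_part_def)

lemma list_mult_len_ball:
  "set gs \<subseteq> len_ball n \<Longrightarrow> list_mult G gs \<in> len_ball (n * length gs)"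
proof (induction gs)
  case (Cons g gs)
  have g: "g \<in> len_ball n" and gs: "list_mult G gs \<in> len_ball (n * length gs)"
    using Cons.IH Cons.prems by simp_all
  have "len (g \<otimes> list_mult G gs) \<le> n + n * length gs"
    using len_mult[OF len_ballD(1)[OF g] len_ballD(1)[OF gs]] len_ballD(2)[OF g] len_ballD(2)[OF gs]
    by linarith
  then show ?case using len_ballD(1)[OF g] len_ballD(1)[OF gs] by (simp add: len_ball_def)
qed (simp add: len_ball_def)

end

section \<open>The random walk\<close>

locale sphere_tail_walk = sphere_tail_law G A \<mu> r\<^sub>0 c + M: prob_space M
  for G :: "('a, 'b) monoid_scheme" (structure) and A :: "'a set" and \<mu> :: "'a measure"
    and r\<^sub>0 :: nat and c :: real and M :: "'w measure" +
  fixes S :: "nat \<Rightarrow> 'w \<Rightarrow> 'a"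
  assumes indep: "M.indep_vars (\<lambda>_. count_space (carrier G)) S {1..}"
    and distr_S: "\<And>k. 1 \<le> k \<Longrightarrow> distr M (count_space (carrier G)) (S k) = \<mu>"
begin

abbreviation X :: "nat \<Rightarrow> 'w \<Rightarrow> 'a" where "X \<equiv> random_walk G S"

lemma measurable_S: "1 \<le> k \<Longrightarrow> S k \<in> measurable M (count_space (carrier G))"
  using indep by (auto simp: M.indep_vars_def2)

lemma S_closed: "1 \<le> k \<Longrightarrow> \<omega> \<in> space M \<Longrightarrow> S k \<omega> \<in> carrier G"
  using measurable_space[OF measurable_S] by simp

lemma measurable_list_mult_S:
  "(\<forall>k\<in>set ks. 1 \<le> k) \<Longrightarrow>
    (\<lambda>\<omega>. list_mult G (map (\<lambda>k. S k \<omega>) ks)) \<in> measurable M (count_space (carrier G))"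
proof (induction ks)
  case (Cons k ks)
  have "(\<lambda>\<omega>. S k \<omega> \<otimes> list_mult G (map (\<lambda>k. S k \<omega>) ks)) \<in> measurable M (count_space (carrier G))"
  proof (rule measurable_compose_countable'[where f = "\<lambda>g \<omega>. g \<otimes> list_mult G (map (\<lambda>k. S k \<omega>) ks)"])
    fix g assume g: "g \<in> carrier G"
    have left: "(\<lambda>h. g \<otimes> h) \<in> measurable (count_space (carrier G)) (count_space (carrier G))"
      using g by simp
    have "(\<lambda>\<omega>. list_mult G (map (\<lambda>k. S k \<omega>) ks)) \<in> measurable M (count_space (carrier G))"
      using Cons.IH Cons.prems by simp
    from measurable_compose[OF this left]
    show "(\<lambda>\<omega>. g \<otimes> list_mult G (map (\<lambda>k. S k \<omega>) ks)) \<in> measurable M (count_space (carrier G))" .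
  next
    show "S k \<in> measurable M (count_space (carrier G))" using Cons.prems by (intro measurable_S) auto
  qed (rule countable_carrier)
  then show ?case by simp
qed simp

lemma measurable_X: "X n \<in> measurable M (count_space (carrier G))"
  unfolding random_walk_def by (rule measurable_list_mult_S) auto

lemma prob_S:
  assumes "1 \<le> k" "B \<subseteq> carrier G"
  shows "M.prob (S k -` B \<inter> space M) = measure \<mu> B"
proof -
  have "measure (distr M (count_space (carrier G)) (S k)) B = M.prob (S k -` B \<inter> space M)"
    by (rule measure_distr[OF measurable_S[OF assms(1)]]) (use assms in simp)
  then show ?thesis by (simp add: distr_S[OF assms(1)])
qed

definition increments :: "nat \<Rightarrow> 'w \<Rightarrow> 'a list" where
  "increments n \<omega> = map (\<lambda>k. S k \<omega>) [1..<Suc n]"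

lemma X_eq: "X n \<omega> = list_mult G (increments n \<omega>)"
  by (simp add: random_walk_def increments_def)

lemma length_increments [simp]: "length (increments n \<omega>) = n"
  by (simp add: increments_def)

lemma increments_nth: "i < n \<Longrightarrow> increments n \<omega> ! i = S (Suc i) \<omega>"
  by (simp add: increments_def del: upt_Suc)

lemma set_increments: "set (increments n \<omega>) = (\<lambda>k. S k \<omega>) ` {1..n}"
  by (simp add: increments_def atLeastLessThanSuc_atLeastAtMost del: upt_Suc)

lemma increments_eq_iff:
  assumes "length gs = n"
  shows "increments n \<omega> = gs \<longleftrightarrow> (\<forall>k\<in>{1..n}. S k \<omega> = gs ! (k - 1))"
proof
  assume *: "increments n \<omega> = gs"
  show "\<forall>k\<in>{1..n}. S k \<omega> = gs ! (k - 1)"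
    unfolding *[symmetric] by (auto simp: increments_nth)
next
  assume *: "\<forall>k\<in>{1..n}. S k \<omega> = gs ! (k - 1)"
  show "increments n \<omega> = gs"
  proof (rule nth_equalityI)
    fix i assume "i < length (increments n \<omega>)"
    then show "increments n \<omega> ! i = gs ! i" using *[rule_format, of "Suc i"] by (simp add: increments_nth)
  qed (simp add: assms)
qed

lemma prob_increments:
  assumes "length gs = n" "set gs \<subseteq> carrier G"
  shows "{\<omega> \<in> space M. increments n \<omega> = gs} \<in> sets M"
    and "M.prob {\<omega> \<in> space M. increments n \<omega> = gs} = prod_list (map (\<lambda>g. measure \<mu> {g}) gs)"
proof -
  have "{\<omega> \<in> space M. increments n \<omega> = gs} \<in> sets M \<and>
    M.prob {\<omega> \<in> space M. increments n \<omega> = gs} = prod_list (map (\<lambda>g. measure \<mu> {g}) gs)"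
  proof (cases "n = 0")
    case True
    then show ?thesis using assms M.prob_space by (simp add: increments_def)
  next
    case False
    let ?E = "\<lambda>k. S k -` {gs ! (k - 1)} \<inter> space M"
    have eq: "{\<omega> \<in> space M. increments n \<omega> = gs} = (\<Inter>k\<in>{1..n}. ?E k)"
      using False by (auto simp: increments_eq_iff[OF assms(1)])
    have g: "{gs ! (k - 1)} \<subseteq> carrier G" if "k \<in> {1..n}" for k
      using assms that nth_mem[of "k - 1" gs] by auto
    have "M.prob (\<Inter>k\<in>{1..n}. ?E k) = (\<Prod>k\<in>{1..n}. M.prob (?E k))"
      by (rule M.indep_varsD[OF indep]) (use False g in auto)
    also have "\<dots> = (\<Prod>k\<in>{1..n}. measure \<mu> {gs ! (k - 1)})"
      using g by (intro prod.cong refl prob_S) auto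
    also have "\<dots> = (\<Prod>i<n. measure \<mu> {gs ! i})"
      by (rule prod.reindex_bij_witness[of _ Suc "\<lambda>k. k - 1"]) auto
    also have "\<dots> = prod_list (map (\<lambda>g. measure \<mu> {g}) gs)"
      using assms(1) by (simp add: prod.list_conv_set_nth atLeast0LessThan)
    finally have "M.prob (\<Inter>k\<in>{1..n}. ?E k) = \<dots>" .
    moreover have "(\<Inter>k\<in>{1..n}. ?E k) \<in> sets M"
      using False g by (intro sets.finite_INT measurable_sets[OF measurable_S]) auto
    ultimately show ?thesis unfolding eq by blast
  qed
  then show "{\<omega> \<in> space M. increments n \<omega> = gs} \<in> sets M"
    and "M.prob {\<omega> \<in> space M. increments n \<omega> = gs} = prod_list (map (\<lambda>g. measure \<mu> {g}) gs)"
    by blast+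
qed

text \<open>
  On the event considered, the total damping of a path is at least \<open>exp (-s l)\<close>, so the law of the
  path is at most \<open>exp (s l)\<close> times the damped law; the latter is summed over end points.
\<close>

lemma prob_far_without_long_part:
  assumes V: "V = {x \<in> len_ball (n * n). t < real (len x)}" and s: "0 \<le> s"
  shows "{\<omega> \<in> space M. set (increments n \<omega>) \<subseteq> len_ball n \<and>
      long_part R (increments n \<omega>) \<le> l \<and> t < real (len (X n \<omega>))} \<in> sets M" (is "?E \<in> _")
    and "M.prob {\<omega> \<in> space M. set (increments n \<omega>) \<subseteq> len_ball n \<and>
      long_part R (increments n \<omega>) \<le> l \<and> t < real (len (X n \<omega>))}
    \<le> exp (s * l) * (\<Sum>x\<in>V. conv_power (len_ball n) (damped R s) n x)"
proof -
  define T where "T = {gs. set gs \<subseteq> len_ball n \<and> length gs = n \<and> long_part R gs \<le> l \<and>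
    t < real (len (list_mult G gs))}"
  let ?I = "\<lambda>gs. {\<omega> \<in> space M. increments n \<omega> = gs}"
  have finT: "finite T"
    by (rule finite_subset[OF _ finite_lists_length_eq[OF finite_len_ball[of n], of n]])
      (auto simp: T_def)
  have T: "length gs = n" "set gs \<subseteq> carrier G" if "gs \<in> T" for gs
    using that len_ball_closed by (auto simp: T_def)
  have E: "?E = (\<Union>gs\<in>T. ?I gs)" by (auto simp: T_def X_eq)
  show "?E \<in> sets M"
    unfolding E using finT prob_increments(1)[OF T] by (intro sets.finite_UN) auto
  have "M.prob ?E = M.prob (\<Union>gs\<in>T. ?I gs)" by (simp only: E)
  also have "\<dots> \<le> (\<Sum>gs\<in>T. M.prob (?I gs))"
    using finT prob_increments(1)[OF T] by (intro M.finite_measure_subadditive_finite) auto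
  also have "\<dots> = (\<Sum>gs\<in>T. exp (s * long_part R gs) * prod_list (map (damped R s) gs))"
    using prob_increments(2)[OF T] by (intro sum.cong refl) (simp add: prod_list_damped[of _ s R])
  also have "\<dots> \<le> (\<Sum>gs\<in>T. exp (s * l) * prod_list (map (damped R s) gs))"
  proof (rule sum_mono)
    fix gs assume "gs \<in> T"
    then have "s * long_part R gs \<le> s * l" using s by (intro mult_left_mono) (auto simp: T_def)
    moreover have "0 \<le> prod_list (map (damped R s) gs)"
      by (induction gs) (auto intro: mult_nonneg_nonneg damped_nonneg)
    ultimately show "exp (s * long_part R gs) * prod_list (map (damped R s) gs)
        \<le> exp (s * l) * prod_list (map (damped R s) gs)"
      by (intro mult_right_mono) auto
  qed
  also have "\<dots> = exp (s * l) * (\<Sum>gs\<in>T. prod_list (map (damped R s) gs))"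
    by (simp add: sum_distrib_left)
  also have "(\<Sum>gs\<in>T. prod_list (map (damped R s) gs)) \<le>
      (\<Sum>x\<in>V. conv_power (len_ball n) (damped R s) n x)"
  proof (rule sum_lists_le_conv_power)
    fix gs assume "gs \<in> T"
    then show "set gs \<subseteq> len_ball n \<and> length gs = n \<and> list_mult G gs \<in> V"
      using list_mult_len_ball[of gs n] by (auto simp: T_def V)
  qed (auto simp: V finite_len_ball len_ball_closed damped_nonneg dest: len_ballD)
  finally show "M.prob ?E \<le> exp (s * l) * (\<Sum>x\<in>V. conv_power (len_ball n) (damped R s) n x)"
    by simp
qed

lemma prob_long_step:
  assumes "r\<^sub>0 \<le> n"
  shows "{\<omega> \<in> space M. \<not> set (increments n \<omega>) \<subseteq> len_ball n} \<in> sets M" (is "?E \<in> _")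
    and "M.prob {\<omega> \<in> space M. \<not> set (increments n \<omega>) \<subseteq> len_ball n} \<le> c / ln (real n)"
proof -
  let ?B = "{g \<in> carrier G. n < len g}"
  have E: "{\<omega> \<in> space M. \<not> set (increments n \<omega>) \<subseteq> len_ball n} = (\<Union>k\<in>{1..n}. S k -` ?B \<inter> space M)"
    using S_closed by (auto simp: set_increments len_ball_def not_le)
  show "?E \<in> sets M"
    unfolding E by (intro sets.finite_UN measurable_sets[OF measurable_S]) auto
  have "M.prob ?E = M.prob (\<Union>k\<in>{1..n}. S k -` ?B \<inter> space M)" by (simp only: E)
  also have "\<dots> \<le> (\<Sum>k\<in>{1..n}. M.prob (S k -` ?B \<inter> space M))"
    using measurable_sets[OF measurable_S, of _ ?B] by (intro M.finite_measure_subadditive_finite) auto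
  also have "\<dots> = (\<Sum>k\<in>{1..n}. measure \<mu> ?B)"
    by (intro sum.cong refl prob_S) auto
  also have "\<dots> = real n * measure \<mu> ?B" by simp
  also have "\<dots> \<le> real n * (c / (real n * ln (real n)))"
    by (intro mult_left_mono tail_le assms) auto
  also have "\<dots> = c / ln (real n)" using assms r\<^sub>0 by simp
  finally show "M.prob ?E \<le> c / ln (real n)" .
qed

lemma expectation_step_finite_support:
  assumes "1 \<le> k" "finite B" "B \<subseteq> carrier G"
  shows "integrable M (\<lambda>\<omega>. f (S k \<omega>) * indicator B (S k \<omega>) :: real)"
    and "M.expectation (\<lambda>\<omega>. f (S k \<omega>) * indicator B (S k \<omega>)) = (\<Sum>g\<in>B. f g * measure \<mu> {g})"
proof -
  have eq: "f (S k \<omega>) * indicator B (S k \<omega>) =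
      (\<Sum>g\<in>B. f g * indicator (S k -` {g} \<inter> space M) \<omega>)" if "\<omega> \<in> space M" for \<omega>
  proof -
    have "(\<Sum>g\<in>B. f g * indicator (S k -` {g} \<inter> space M) \<omega>) =
        (\<Sum>g\<in>B. if g = S k \<omega> then f g else 0)"
      using that by (intro sum.cong refl) (auto simp: indicator_def)
    then show ?thesis using assms(2) by (simp add: indicator_def)
  qed
  have sets: "S k -` {g} \<inter> space M \<in> sets M" if "g \<in> B" for g
    using assms that by (intro measurable_sets[OF measurable_S]) auto
  have int: "integrable M (\<lambda>\<omega>. f g * indicator (S k -` {g} \<inter> space M) \<omega> :: real)" if "g \<in> B" for g
    using sets[OF that] by (intro integrable_mult_right integrable_real_indicator)
      (auto simp: M.emeasure_eq_measure)
  have "integrable M (\<lambda>\<omega>. \<Sum>g\<in>B. f g * indicator (S k -` {g} \<inter> space M) \<omega> :: real)"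
    using int by (intro Bochner_Integration.integrable_sum)
  then show "integrable M (\<lambda>\<omega>. f (S k \<omega>) * indicator B (S k \<omega>) :: real)"
    using eq by (subst Bochner_Integration.integrable_cong[OF refl, OF eq]) auto
  have "M.expectation (\<lambda>\<omega>. f (S k \<omega>) * indicator B (S k \<omega>)) =
      M.expectation (\<lambda>\<omega>. \<Sum>g\<in>B. f g * indicator (S k -` {g} \<inter> space M) \<omega>)"
    using eq by (intro Bochner_Integration.integral_cong) auto
  also have "\<dots> = (\<Sum>g\<in>B. M.expectation (\<lambda>\<omega>. f g * indicator (S k -` {g} \<inter> space M) \<omega>))"
    using int by (intro Bochner_Integration.integral_sum)
  also have "\<dots> = (\<Sum>g\<in>B. f g * measure \<mu> {g})"
  proof (intro sum.cong refl)
    fix g assume "g \<in> B"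
    then show "M.expectation (\<lambda>\<omega>. f g * indicator (S k -` {g} \<inter> space M) \<omega>) = f g * measure \<mu> {g}"
      using sets[of g] prob_S[OF assms(1), of "{g}"] subsetD[OF assms(3), of g] by simp
  qed
  finally show "M.expectation (\<lambda>\<omega>. f (S k \<omega>) * indicator B (S k \<omega>)) = (\<Sum>g\<in>B. f g * measure \<mu> {g})" .
qed

text \<open>
  Markov's inequality for the total length of the steps longer than \<open>R\<close>, where the steps are cut
  off at \<open>n\<close> to make the expectation finite.
\<close>

lemma prob_large_long_part:
  assumes "r\<^sub>0 \<le> R" "R \<le> n" "0 < l"
  shows "{\<omega> \<in> space M. set (increments n \<omega>) \<subseteq> len_ball n \<and> l < long_part R (increments n \<omega>)} \<subseteq>
      {\<omega> \<in> space M. l \<le> (\<Sum>k\<in>{1..n}. real (len (S k \<omega>)) *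
        indicator {g \<in> carrier G. len g \<in> {R<..n}} (S k \<omega>))}" (is "_ \<subseteq> ?E")
    and "{\<omega> \<in> space M. l \<le> (\<Sum>k\<in>{1..n}. real (len (S k \<omega>)) *
        indicator {g \<in> carrier G. len g \<in> {R<..n}} (S k \<omega>))} \<in> sets M"
    and "M.prob {\<omega> \<in> space M. l \<le> (\<Sum>k\<in>{1..n}. real (len (S k \<omega>)) *
        indicator {g \<in> carrier G. len g \<in> {R<..n}} (S k \<omega>))}
      \<le> real n * (c * ln (real n / real R) / ln (real R)) / l"
proof -
  let ?B = "{g \<in> carrier G. len g \<in> {R<..n}}"
  let ?f = "\<lambda>k \<omega>. real (len (S k \<omega>)) * indicator ?B (S k \<omega>) :: real"
  have fin: "finite ?B"
    by (rule finite_subset[OF _ finite_len_ball[of n]]) (auto simp: len_ball_def)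
  have int: "integrable M (\<lambda>\<omega>. \<Sum>k\<in>{1..n}. ?f k \<omega>)"
    using fin by (intro Bochner_Integration.integrable_sum expectation_step_finite_support) auto
  show "?E \<in> sets M"
    using borel_measurable_integrable[OF int] by measurable
  have "M.prob ?E \<le> M.expectation (\<lambda>\<omega>. \<Sum>k\<in>{1..n}. ?f k \<omega>) / l"
    using int assms(3) by (intro integral_Markov_inequality_measure[where A = "{}"])
      (auto intro!: AE_I2 sum_nonneg)
  also have "M.expectation (\<lambda>\<omega>. \<Sum>k\<in>{1..n}. ?f k \<omega>) = (\<Sum>k\<in>{1..n}. M.expectation (?f k))"
    using fin by (intro Bochner_Integration.integral_sum expectation_step_finite_support) auto
  also have "\<dots> = (\<Sum>k\<in>{1..n}. \<Sum>g\<in>?B. real (len g) * measure \<mu> {g})"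
    using fin by (intro sum.cong refl expectation_step_finite_support) auto
  also have "\<dots> = real n * (\<Sum>g\<in>?B. real (len g) * measure \<mu> {g})" by simp
  also have "\<dots> / l \<le> real n * (c * ln (real n / real R) / ln (real R)) / l"
    using assms by (intro divide_right_mono mult_left_mono middle_first_moment) auto
  finally show "M.prob ?E \<le> real n * (c * ln (real n / real R) / ln (real R)) / l" .
  show "{\<omega> \<in> space M. set (increments n \<omega>) \<subseteq> len_ball n \<and> l < long_part R (increments n \<omega>)} \<subseteq> ?E"
  proof (rule subsetI)
    fix \<omega> assume "\<omega> \<in> {\<omega> \<in> space M. set (increments n \<omega>) \<subseteq> len_ball n \<and>
      l < long_part R (increments n \<omega>)}"
    then have \<omega>: "\<omega> \<in> space M" "set (increments n \<omega>) \<subseteq> len_ball n"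
      "l < long_part R (increments n \<omega>)" by auto
    have "long_part R (increments n \<omega>) =
        (\<Sum>k\<in>{1..n}. if R < len (S k \<omega>) then real (len (S k \<omega>)) else 0)"
      unfolding long_part_def increments_def
      by (simp add: sum_list_distinct_conv_sum_set o_def atLeastLessThanSuc_atLeastAtMost del: upt_Suc)
    also have "\<dots> = (\<Sum>k\<in>{1..n}. ?f k \<omega>)"
    proof (rule sum.cong[OF refl])
      fix k assume k: "k \<in> {1..n}"
      then have "S k \<omega> \<in> set (increments n \<omega>)" by (auto simp: set_increments)
      then have "S k \<omega> \<in> carrier G" "len (S k \<omega>) \<le> n" using \<omega>(2) len_ballD by blast+
      then show "(if R < len (S k \<omega>) then real (len (S k \<omega>)) else 0) = ?f k \<omega>" by simp
    qed
    finally have "l \<le> (\<Sum>k\<in>{1..n}. ?f k \<omega>)" using \<omega>(3) by (simp only:)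
    then show "\<omega> \<in> ?E" using \<omega>(1) by blast
  qed
qed

text \<open>
  The three terms account for a step longer than \<open>n\<close>, for long steps of total length above
  \<open>\<epsilon> n / 2\<close>, and for the walk going far without either.
\<close>

lemma prob_far_le:
  assumes R: "r\<^sub>0 \<le> R" "R \<le> n" and \<epsilon>: "0 < \<epsilon>"
  shows "M.prob {\<omega> \<in> space M. \<epsilon> * real n < real (len (X n \<omega>))} \<le>
    c / ln (real n) + 2 * c / \<epsilon> * (ln (real n / real R) / ln (real R)) +
    real (card (len_ball (n * n))) * (4 * (real n + 1)) *
      exp (- (\<epsilon> / 4) * sqrt (real n / (((real r\<^sub>0)\<^sup>2 + c) * real R)))"
proof -
  define C where "C = (real r\<^sub>0)\<^sup>2 + c"
  \<comment> \<open>this rate makes the excess \<open>\<kappa> - 1\<close> equal to \<open>1 / (4n)\<close>, a quarter of the killing rate \<open>1 / n\<close> below\<close>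
  define s where "s = 1 / sqrt (4 * C * real n * real R)"
  \<comment> \<open>killing at this rate loses at most a factor \<open>3\<close> over \<open>n\<close> steps (\<open>qn\<close> below)\<close>
  define q where "q = 1 / (1 + 1 / real n)"
  define \<kappa> where "\<kappa> = 1 + s\<^sup>2 * (C * real R)"
  define l where "l = \<epsilon> * real n / 2"
  define V where "V = {x \<in> len_ball (n * n). \<epsilon> * real n < real (len x)}"
  have pos: "0 < real n" "0 < real R" "1 \<le> R" "0 < n" using R r\<^sub>0 by auto
  have "1 \<le> (real r\<^sub>0)\<^sup>2" using r\<^sub>0 by (intro one_le_power) auto
  then have C: "1 \<le> C" "0 < C" using c by (auto simp: C_def)
  have s: "0 < s" using C pos by (simp add: s_def)
  have s2: "s\<^sup>2 = 1 / (4 * C * real n * real R)"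
    using C pos by (simp add: s_def power_divide)
  have \<kappa>: "\<kappa> = 1 + 1 / (4 * real n)"
    using C pos by (simp add: \<kappa>_def s2)
  have gap: "1 - q * \<kappa> = 3 / (4 * (real n + 1))"
  proof -
    have "q = real n / (real n + 1)" using pos by (simp add: q_def field_simps)
    moreover have "\<kappa> = (4 * real n + 1) / (4 * real n)" using pos by (simp add: \<kappa> field_simps)
    ultimately have "q * \<kappa> = (4 * real n + 1) / (4 * (real n + 1))" using pos by simp
    then show ?thesis by (simp add: field_simps)
  qed
  have sR: "s * real R \<le> 1"
  proof -
    have "(s * real R)\<^sup>2 = s\<^sup>2 * (real R * real R)" by (simp add: power2_eq_square)
    also have "\<dots> = real R / (4 * C * real n)" using pos C by (simp add: s2)
    also have "\<dots> \<le> 1"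
    proof -
      have "real R * 1 \<le> real n * (4 * C)" using R(2) C by (intro mult_mono) auto
      then show ?thesis using pos C by (simp add: mult_ac)
    qed
    finally show ?thesis using s by (simp add: power_le_one_iff abs_le_square_iff)
  qed
  have q: "0 < q" using pos by (simp add: q_def add_pos_nonneg)
  have qn: "1 / q ^ n \<le> 3"
    using one_plus_inverse_power_le_3[of n n] pos by (simp add: q_def power_one_over)
  let ?E1 = "{\<omega> \<in> space M. \<not> set (increments n \<omega>) \<subseteq> len_ball n}"
  let ?E2 = "{\<omega> \<in> space M. l \<le> (\<Sum>k\<in>{1..n}. real (len (S k \<omega>)) *
        indicator {g \<in> carrier G. len g \<in> {R<..n}} (S k \<omega>))}"
  let ?E3 = "{\<omega> \<in> space M. set (increments n \<omega>) \<subseteq> len_ball n \<and>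
      long_part R (increments n \<omega>) \<le> l \<and> \<epsilon> * real n < real (len (X n \<omega>))}"
  have l: "0 < l" using \<epsilon> pos by (simp add: l_def)
  have m1: "?E1 \<in> sets M" using R by (intro prob_long_step(1)) auto
  have m3: "?E3 \<in> sets M" using s by (intro prob_far_without_long_part(1)) auto
  have "M.prob {\<omega> \<in> space M. \<epsilon> * real n < real (len (X n \<omega>))} \<le> M.prob ((?E1 \<union> ?E2) \<union> ?E3)"
  proof (rule M.finite_measure_mono)
    show "{\<omega> \<in> space M. \<epsilon> * real n < real (len (X n \<omega>))} \<subseteq> (?E1 \<union> ?E2) \<union> ?E3"
    proof
      fix \<omega> assume \<omega>: "\<omega> \<in> {\<omega> \<in> space M. \<epsilon> * real n < real (len (X n \<omega>))}"
      show "\<omega> \<in> (?E1 \<union> ?E2) \<union> ?E3"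
        using \<omega> subsetD[OF prob_large_long_part(1)[OF R l], of \<omega>] by (auto simp: not_le)
    qed
    show "(?E1 \<union> ?E2) \<union> ?E3 \<in> sets M"
      by (intro sets.Un m1 m3 prob_large_long_part(2)[OF R l])
  qed
  also have "\<dots> \<le> M.prob (?E1 \<union> ?E2) + M.prob ?E3"
    by (intro measure_Un_le sets.Un m1 m3 prob_large_long_part(2)[OF R l])
  also have "\<dots> \<le> (M.prob ?E1 + M.prob ?E2) + M.prob ?E3"
    by (intro add_right_mono measure_Un_le m1 prob_large_long_part(2)[OF R l])
  also have "\<dots> \<le> (c / ln (real n) + real n * (c * ln (real n / real R) / ln (real R)) / l) +
      exp (s * l) * (\<Sum>x\<in>V. conv_power (len_ball n) (damped R s) n x)"
    using R s by (intro add_mono prob_long_step(2) prob_large_long_part(3)[OF R l]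
      prob_far_without_long_part(2) V_def) auto
  also have "(\<Sum>x\<in>V. conv_power (len_ball n) (damped R s) n x) \<le>
      (\<Sum>x\<in>V. exp (- s * (\<epsilon> * real n)) * (4 * (real n + 1)))"
  proof (rule sum_mono)
    fix x assume x: "x \<in> V"
    have "conv_power (len_ball n) (damped R s) n x \<le>
        exp (- s * real (len x)) / (q ^ n * (1 - q * \<kappa>))"
    proof (rule conv_power_le_Green)
      show "(\<Sum>g\<in>len_ball n. damped R s g * cosh (s * real (len g))) \<le> \<kappa>"
        unfolding \<kappa>_def C_def using pos R s sR by (intro damped_cosh_le) auto
      show "0 < q" by (rule q)
      have "0 < 3 / (4 * (real n + 1))" by simp
      then show "q * \<kappa> < 1" using gap by linarith
    qed (use x s pos damped_nonneg damped_inv in \<open>auto simp: V_def\<close>)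
    also have "\<dots> = exp (- s * real (len x)) * ((1 / q ^ n) * (1 / (1 - q * \<kappa>)))" by simp
    also have "\<dots> \<le> exp (- s * (\<epsilon> * real n)) * (3 * (1 / (1 - q * \<kappa>)))"
      using x s qn q unfolding V_def gap
      by (intro mult_mono) (auto intro: mult_left_mono)
    also have "3 * (1 / (1 - q * \<kappa>)) = 4 * (real n + 1)"
      unfolding gap by simp
    finally show "conv_power (len_ball n) (damped R s) n x \<le>
        exp (- s * (\<epsilon> * real n)) * (4 * (real n + 1))" .
  qed
  also have "\<dots> \<le> real (card (len_ball (n * n))) * (exp (- s * (\<epsilon> * real n)) * (4 * (real n + 1)))"
    using card_mono[OF finite_len_ball, of V "n * n"]
    by (simp add: V_def mult_right_mono)
  also have "exp (s * l) * (real (card (len_ball (n * n))) * (exp (- s * (\<epsilon> * real n)) * (4 * (real n + 1)))) =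
      real (card (len_ball (n * n))) * (4 * (real n + 1)) * (exp (s * l) * exp (- s * (\<epsilon> * real n)))"
    by simp
  also have "exp (s * l) * exp (- s * (\<epsilon> * real n)) = exp (- (\<epsilon> / 4) * sqrt (real n / (C * real R)))"
  proof -
    have "sqrt (real n / (C * real R)) = 2 * real n * s"
    proof (rule real_sqrt_unique)
      have "(2 * real n * s)\<^sup>2 = s\<^sup>2 * (4 * (real n * real n))" by (simp add: power2_eq_square)
      also have "\<dots> = real n / (C * real R)" using pos C by (simp add: s2)
      finally show "(2 * real n * s)\<^sup>2 = real n / (C * real R)" .
    qed (use s pos in auto)
    then show ?thesis by (simp add: exp_add[symmetric] l_def)
  qed
  also have "real n * (c * ln (real n / real R) / ln (real R)) / l =
      2 * c / \<epsilon> * (ln (real n / real R) / ln (real R))"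
    using pos \<epsilon> by (simp add: l_def mult_ac)
  finally show ?thesis by (simp add: C_def)
qed

end

section \<open>Infinite mean\<close>

text \<open>
  A telescoping minorant: by \<open>log y \<le> y - 1\<close>, used once for the outer and once for the inner
  logarithm, each term dominates an increment of \<open>log log\<close>.
\<close>

lemma one_over_r_ln_r_ge:
  assumes "3 \<le> r"
  shows "ln (ln (real (Suc r))) - ln (ln (real r)) \<le> 1 / (real r * ln (real r))"
proof -
  have r: "0 < ln (real r)" "0 < ln (real (Suc r))" "0 < real r" using assms by auto
  have "ln (ln (real (Suc r))) - ln (ln (real r)) = ln (ln (real (Suc r)) / ln (real r))"
    using r by (simp add: ln_div)
  also have "\<dots> \<le> ln (real (Suc r)) / ln (real r) - 1"
    using r by (intro ln_le_minus_one divide_pos_pos)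
  also have "\<dots> = ln (real (Suc r) / real r) / ln (real r)"
    using r by (simp add: ln_div diff_divide_distrib)
  also have "\<dots> \<le> (real (Suc r) / real r - 1) / ln (real r)"
    using r by (intro divide_right_mono ln_le_minus_one) auto
  also have "\<dots> = 1 / (real r * ln (real r))" using r by (simp add: field_simps)
  finally show ?thesis .
qed

lemma sum_one_over_r_ln_r_ge:
  assumes "3 \<le> m" "m \<le> N"
  shows "ln (ln (real N)) - ln (ln (real m)) \<le> (\<Sum>r\<in>{m..<N}. 1 / (real r * ln (real r)))"
  using assms(2)
proof (induction N rule: dec_induct)
  case (step N)
  then show ?case using one_over_r_ln_r_ge[of N] assms(1) by simp
qed simp

context sphere_tail_law
begin

lemma nn_integral_ge_finite:
  assumes "finite B" "B \<subseteq> carrier G"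
  shows "ennreal (\<Sum>g\<in>B. real (len g) * measure \<mu> {g}) \<le> (\<integral>\<^sup>+g. ennreal (real (len g)) \<partial>\<mu>)"
proof -
  have "ennreal (\<Sum>g\<in>B. real (len g) * measure \<mu> {g}) = (\<Sum>g\<in>B. ennreal (real (len g)) * emeasure \<mu> {g})"
    by (simp add: \<mu>.emeasure_eq_measure ennreal_mult[symmetric] sum_ennreal)
  also have "\<dots> = (\<Sum>g\<in>B. \<integral>\<^sup>+x. ennreal (real (len g)) * indicator {g} x \<partial>\<mu>)"
    using assms by (intro sum.cong refl nn_integral_cmult_indicator[symmetric]) (auto simp: sets_\<mu>_iff)
  also have "\<dots> = (\<integral>\<^sup>+x. (\<Sum>g\<in>B. ennreal (real (len g)) * indicator {g} x) \<partial>\<mu>)"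
    using assms by (intro nn_integral_sum[symmetric] borel_measurable_times_ennreal
      borel_measurable_indicator) (auto simp: sets_\<mu>_iff)
  also have "\<dots> \<le> (\<integral>\<^sup>+g. ennreal (real (len g)) \<partial>\<mu>)"
  proof (rule nn_integral_mono)
    fix x
    have "(\<Sum>g\<in>B. ennreal (real (len g)) * indicator {g} x) =
        (\<Sum>g\<in>B. if g = x then ennreal (real (len g)) else 0)"
      by (intro sum.cong refl) auto
    then show "(\<Sum>g\<in>B. ennreal (real (len g)) * indicator {g} x) \<le> ennreal (real (len x))"
      using assms(1) by simp
  qed
  finally show ?thesis .
qed

lemma infinite_mean_length:
  assumes b: "0 < b"
    and lower: "\<And>r. r\<^sub>0 \<le> r \<Longrightarrow> b / ((real r)\<^sup>2 * ln (real r)) \<le> sphere_mass r"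
  shows "(\<integral>\<^sup>+g. ennreal (real (len g)) \<partial>\<mu>) = \<infinity>"
proof (rule ccontr)
  assume "(\<integral>\<^sup>+g. ennreal (real (len g)) \<partial>\<mu>) \<noteq> \<infinity>"
  then obtain I where I: "0 \<le> I" "(\<integral>\<^sup>+g. ennreal (real (len g)) \<partial>\<mu>) = ennreal I"
    by (cases "\<integral>\<^sup>+g. ennreal (real (len g)) \<partial>\<mu>") auto
  have bound: "b * (ln (ln (real N)) - ln (ln (real r\<^sub>0))) \<le> I" if N: "r\<^sub>0 \<le> N" for N
  proof -
    let ?B = "{g \<in> carrier G. len g \<in> {r\<^sub>0..<N}}"
    have fin: "finite ?B"
      by (rule finite_subset[OF _ finite_len_ball[of N]]) (auto simp: len_ball_def)
    have "b * (ln (ln (real N)) - ln (ln (real r\<^sub>0))) \<le>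
        b * (\<Sum>r\<in>{r\<^sub>0..<N}. 1 / (real r * ln (real r)))"
      using b N r\<^sub>0 by (intro mult_left_mono sum_one_over_r_ln_r_ge) auto
    also have "\<dots> = (\<Sum>r\<in>{r\<^sub>0..<N}. real r * (b / ((real r)\<^sup>2 * ln (real r))))"
      unfolding sum_distrib_left using r\<^sub>0
      by (intro sum.cong refl) (auto simp: power2_eq_square)
    also have "\<dots> \<le> (\<Sum>r\<in>{r\<^sub>0..<N}. real r * sphere_mass r)"
      by (intro sum_mono mult_left_mono lower) auto
    also have "\<dots> = (\<Sum>g\<in>?B. real (len g) * measure \<mu> {g})"
      by (rule sum_shells[symmetric]) simp
    also have "\<dots> \<le> I"
      using nn_integral_ge_finite[OF fin] I by (simp add: ennreal_le_iff)
    finally show ?thesis .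
  qed
  have "filterlim (\<lambda>N::nat. b * (ln (ln (real N)) - ln (ln (real r\<^sub>0)))) at_top sequentially"
    using b by real_asymp
  then have "eventually (\<lambda>N::nat. I < b * (ln (ln (real N)) - ln (ln (real r\<^sub>0)))) sequentially"
    by (simp add: filterlim_at_top_dense)
  with eventually_ge_at_top[of r\<^sub>0] have "eventually (\<lambda>N::nat. False) sequentially"
    by eventually_elim (use bound in force)
  then show False by simp
qed

end

context sphere_tail_walk
begin

lemma nn_integral_length_X1:
  "(\<integral>\<^sup>+\<omega>. ennreal (real (len (X 1 \<omega>))) \<partial>M) = (\<integral>\<^sup>+g. ennreal (real (len g)) \<partial>\<mu>)"
proof -
  have "(\<integral>\<^sup>+\<omega>. ennreal (real (len (X 1 \<omega>))) \<partial>M) = (\<integral>\<^sup>+\<omega>. ennreal (real (len (S 1 \<omega>))) \<partial>M)"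
    using S_closed by (intro nn_integral_cong) (simp add: random_walk_def)
  also have "\<dots> = (\<integral>\<^sup>+g. ennreal (real (len g)) \<partial>distr M (count_space (carrier G)) (S 1))"
    by (rule nn_integral_distr[symmetric]) (auto intro: measurable_S)
  finally show ?thesis by (simp add: distr_S)
qed

lemma measurable_length_X: "(\<lambda>\<omega>. real (len (X n \<omega>)) / real n) \<in> borel_measurable M"
  by (rule measurable_compose[OF measurable_X]) simp

section \<open>Sublinear growth in probability\<close>

text \<open>
  With \<open>R\<close> about \<open>n / log\<^sup>4 n\<close>, the middle term of the bound in \<open>prob_far_le\<close> is of order
  \<open>log log n / log n\<close>, and the exponent in the last term is of order \<open>log\<^sup>2 n\<close>, which dominates the
  logarithm of the polynomial volume of the ball.
\<close>

lemma prob_far_tendsto_0: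
  assumes growth: "\<And>n. card (len_ball n) \<le> K * (n + 1) ^ D" and \<epsilon>: "0 < \<epsilon>"
  shows "(\<lambda>n. M.prob {\<omega> \<in> space M. \<epsilon> * real n < real (len (X n \<omega>))}) \<longlonglongrightarrow> 0"
proof -
  define C where "C = (real r\<^sub>0)\<^sup>2 + c"
  define a where "a = real (2 * D + 1)"
  define b where "b = \<epsilon> / (4 * sqrt C)"
  have C: "0 < C" using c by (simp add: C_def add_nonneg_pos)
  have b: "0 < b" using \<epsilon> C by (simp add: b_def)
  let ?p = "\<lambda>n. M.prob {\<omega> \<in> space M. \<epsilon> * real n < real (len (X n \<omega>))}"
  let ?u = "\<lambda>n. c / ln (real n) +
    2 * c / \<epsilon> * (ln (2 * ln (real n) ^ 4) / ln (real n / (2 * ln (real n) ^ 4))) +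
    real K * 4 * exp (a * ln (2 * real n) - b * (ln (real n))\<^sup>2)"
  have ev1: "eventually (\<lambda>n::nat. real n / ln (real n) ^ 4 - 1 \<ge> real n / (2 * ln (real n) ^ 4)) sequentially"
    by real_asymp
  have ev2: "eventually (\<lambda>n::nat. real n / (2 * ln (real n) ^ 4) \<ge> real r\<^sub>0) sequentially"
    by real_asymp
  have ev3: "eventually (\<lambda>n::nat. ln (real n) \<ge> 1) sequentially"
    by real_asymp
  have "eventually (\<lambda>n. ?p n \<le> ?u n) sequentially"
    using ev1 ev2 ev3 eventually_ge_at_top[of 3]
  proof eventually_elim
    case (elim n)
    define L where "L = ln (real n)"
    define R where "R = nat \<lfloor>real n / L ^ 4\<rfloor>"
    have L: "1 \<le> L" "1 \<le> L ^ 4" using elim(3) by (auto simp: L_def)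
    have n: "0 < real n" using elim(4) by simp
    have Rle: "real R \<le> real n / L ^ 4"
      unfolding R_def using L n by (simp add: of_nat_nat)
    have Rge: "real n / (2 * L ^ 4) \<le> real R"
    proof -
      have "real n / L ^ 4 - 1 \<le> real R" unfolding R_def by linarith
      then show ?thesis using elim(1) by (simp add: L_def)
    qed
    have R0: "r\<^sub>0 \<le> R" using Rge elim(2) by (simp add: L_def)
    have "real n / L ^ 4 \<le> real n / 1" using L n by (intro divide_left_mono) auto
    then have Rn: "R \<le> n" using Rle by simp
    have Rpos: "0 < real R" "1 < real R" using R0 r\<^sub>0 by auto
    have "?p n \<le> c / ln (real n) + 2 * c / \<epsilon> * (ln (real n / real R) / ln (real R)) +
      real (card (len_ball (n * n))) * (4 * (real n + 1)) *
        exp (- (\<epsilon> / 4) * sqrt (real n / (C * real R)))"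
      unfolding C_def by (rule prob_far_le[OF R0 Rn \<epsilon>])
    also have "2 * c / \<epsilon> * (ln (real n / real R) / ln (real R)) \<le>
        2 * c / \<epsilon> * (ln (2 * L ^ 4) / ln (real n / (2 * L ^ 4)))"
    proof (intro mult_left_mono frac_le)
      show "0 \<le> 2 * c / \<epsilon>" using c \<epsilon> by simp
      have "1 < real n / (2 * L ^ 4)" using elim(2) r\<^sub>0 by (simp add: L_def)
      then show "0 < ln (real n / (2 * L ^ 4))" by simp
      have "1 \<le> 2 * L ^ 4" using L(2) by linarith
      then show "0 \<le> ln (2 * L ^ 4)" by simp
      show "ln (real n / (2 * L ^ 4)) \<le> ln (real R)"
        using Rge L n Rpos by (subst ln_le_cancel_iff) auto
      have "real n / real R \<le> 2 * L ^ 4"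
        using Rge L Rpos by (simp add: field_simps)
      then show "ln (real n / real R) \<le> ln (2 * L ^ 4)"
        using L n Rpos by (subst ln_le_cancel_iff) auto
    qed
    also have "real (card (len_ball (n * n))) * (4 * (real n + 1)) *
        exp (- (\<epsilon> / 4) * sqrt (real n / (C * real R))) \<le>
        (real K * 4 * (2 * real n) ^ (2 * D + 1)) * exp (- b * L\<^sup>2)"
    proof (rule mult_mono)
      have "real (card (len_ball (n * n))) \<le> real (K * (n * n + 1) ^ D)"
        using growth[of "n * n"] by (simp only: of_nat_le_iff)
      also have "\<dots> = real K * (real n * real n + 1) ^ D" by (simp add: add.commute)
      also have "\<dots> \<le> real K * ((2 * real n)\<^sup>2) ^ D"
      proof -
        have "1 * 1 \<le> real n * real n" using elim(4) by (intro mult_mono) auto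
        then show ?thesis by (intro mult_left_mono power_mono) (auto simp: power2_eq_square)
      qed
      finally have "real (card (len_ball (n * n))) * (4 * (real n + 1)) \<le>
          (real K * ((2 * real n)\<^sup>2) ^ D) * (4 * (2 * real n))"
        using elim(4) by (intro mult_mono) auto
      also have "\<dots> = real K * 4 * (2 * real n) ^ (2 * D + 1)"
        by (simp only: power_add power_mult power_one_right mult.assoc)
      finally show "real (card (len_ball (n * n))) * (4 * (real n + 1)) \<le>
          real K * 4 * (2 * real n) ^ (2 * D + 1)" .
      have "L ^ 4 / C \<le> real n / (C * real R)"
        using Rle L C Rpos n by (simp add: field_simps)
      then have "sqrt (L ^ 4 / C) \<le> sqrt (real n / (C * real R))" by simp
      moreover have "sqrt (L ^ 4 / C) = L\<^sup>2 / sqrt C"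
      proof -
        have "L ^ 4 = (L\<^sup>2)\<^sup>2" by simp
        then show ?thesis by (simp only: real_sqrt_divide real_sqrt_abs) simp
      qed
      ultimately have "\<epsilon> / 4 * (L\<^sup>2 / sqrt C) \<le> \<epsilon> / 4 * sqrt (real n / (C * real R))"
        using \<epsilon> by (intro mult_left_mono) auto
      then show "exp (- (\<epsilon> / 4) * sqrt (real n / (C * real R))) \<le> exp (- b * L\<^sup>2)"
        by (simp add: b_def mult_ac)
    qed auto
    also have "(real K * 4 * (2 * real n) ^ (2 * D + 1)) * exp (- b * L\<^sup>2) =
        real K * 4 * exp (a * ln (2 * real n) - b * L\<^sup>2)"
    proof -
      have "(2 * real n) ^ (2 * D + 1) = exp (ln (2 * real n)) ^ (2 * D + 1)" using n by simp
      also have "\<dots> = exp (a * ln (2 * real n))"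
        unfolding a_def by (rule exp_of_nat_mult[symmetric])
      finally show ?thesis by (simp add: exp_add[symmetric] exp_diff exp_minus divide_inverse)
    qed
    finally show ?case by (simp add: L_def)
  qed
  moreover have "?u \<longlonglongrightarrow> 0"
  proof -
    have "(\<lambda>n::nat. c / ln (real n)) \<longlonglongrightarrow> 0" by real_asymp
    moreover have "(\<lambda>n::nat. ln (2 * ln (real n) ^ 4) / ln (real n / (2 * ln (real n) ^ 4))) \<longlonglongrightarrow> 0"
      by real_asymp
    moreover have "(\<lambda>n::nat. exp (a * ln (2 * real n) - b * (ln (real n))\<^sup>2)) \<longlonglongrightarrow> 0"
      using b by real_asymp
    ultimately have "?u \<longlonglongrightarrow> 0 + 2 * c / \<epsilon> * 0 + real K * 4 * 0"
      by (intro tendsto_add tendsto_mult tendsto_const)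
    then show ?thesis by simp
  qed
  ultimately show ?thesis
    by (intro tendsto_sandwich[of "\<lambda>_. 0" ?p sequentially ?u 0]) auto
qed

end

theorem theoremG:
  fixes G :: "('a, 'b) monoid_scheme"
    and A :: "'a set"
    and \<mu> :: "'a measure"
    and r\<^sub>0 :: nat
    and c\<^sub>1 c\<^sub>2 :: real
    and M :: "'w measure"
    and S :: "nat \<Rightarrow> 'w \<Rightarrow> 'a"
  assumes "group G" and "nilpotent_group G" and "torsion_free G"
    and "finite A" and "symmetric_generating_set G A"
    and "prob_space \<mu>" and "sets \<mu> = sets (count_space (carrier G))"
    and "symmetric_measure G \<mu>"
    and "r\<^sub>0 \<ge> 3" and "0 < c\<^sub>1" and "c\<^sub>1 \<le> c\<^sub>2"
    and "\<And>r::nat. r \<ge> r\<^sub>0 \<Longrightarrow>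
      c\<^sub>1 / (real r ^ 2 * ln (real r)) \<le> (\<Sum>g | g \<in> carrier G \<and> word_length G A g = r. measure \<mu> {g}) \<and>
      (\<Sum>g | g \<in> carrier G \<and> word_length G A g = r. measure \<mu> {g}) \<le> c\<^sub>2 / (real r ^ 2 * ln (real r))"
    and "prob_space M"
    and "prob_space.indep_vars M (\<lambda>_. count_space (carrier G)) S {1..}"
    and "\<And>k. k \<ge> 1 \<Longrightarrow> distr M (count_space (carrier G)) (S k) = \<mu>"
  shows "(\<integral>\<^sup>+\<omega>. ennreal (real (word_length G A (random_walk G S 1 \<omega>))) \<partial>M) = \<infinity> \<and>
    tendsto_in_prob M (\<lambda>n \<omega>. real (word_length G A (random_walk G S n \<omega>)) / real n) 0"
proof -
  interpret fg_group G A
    by (intro fg_group.intro fg_group_axioms.intro assms)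
  interpret sphere_tail_law G A \<mu> r\<^sub>0 c\<^sub>2
    by (intro sphere_tail_law.intro sphere_tail_law_axioms.intro fg_group_axioms)
      (use assms in \<open>auto intro: less_le_trans\<close>)
  interpret sphere_tail_walk G A \<mu> r\<^sub>0 c\<^sub>2 M S
    by (intro sphere_tail_walk.intro sphere_tail_walk_axioms.intro sphere_tail_law_axioms assms)
  obtain K D where growth: "\<And>n. card (word_ball G A n) \<le> K * (n + 1) ^ D"
    using nilpotent_polynomial_growth[OF assms(2,4) gens_closed] by blast
  have "(\<lambda>n. M.prob {\<omega> \<in> space M. \<bar>real (len (X n \<omega>)) / real n - 0\<bar> > \<epsilon>}) \<longlonglongrightarrow> 0"
    if \<epsilon>: "0 < \<epsilon>" for \<epsilon> :: real
  proof (rule Lim_transform_eventually)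
    show "(\<lambda>n. M.prob {\<omega> \<in> space M. \<epsilon> * real n < real (len (X n \<omega>))}) \<longlonglongrightarrow> 0"
      using growth \<epsilon> by (intro prob_far_tendsto_0) (simp_all only: len_ball_eq_word_ball)
    show "eventually (\<lambda>n. M.prob {\<omega> \<in> space M. \<epsilon> * real n < real (len (X n \<omega>))} =
        M.prob {\<omega> \<in> space M. \<bar>real (len (X n \<omega>)) / real n - 0\<bar> > \<epsilon>}) sequentially"
      using eventually_gt_at_top[of 0] by eventually_elim (simp add: pos_less_divide_eq)
  qed
  moreover have "(\<integral>\<^sup>+\<omega>. ennreal (real (len (X 1 \<omega>))) \<partial>M) = \<infinity>"
    unfolding nn_integral_length_X1
    by (rule infinite_mean_length[OF assms(10)]) (use assms(12) in \<open>simp add: sphere_mass_def\<close>)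
  ultimately show ?thesis
    unfolding tendsto_in_prob_def using measurable_length_X by blast
qed

end
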